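(* For any Jordan curve $\Gamma$ in $\mathbb{C}$ and every $\epsilon>0$, there exist an MP-solvable Jordan curve $\Gamma'$ and a Jordan curve $\Gamma''$ that is not MP-solvable such that $$\operatorname{dist}_H(\Gamma,\Gamma')<\epsilon\quad\text{and}\quad\operatorname{dist}_H(\Gamma,\Gamma'')<\epsilon.$$
   Context: $\operatorname{dist}_H$ denotes the Hausdorff distance between compact subsets of $\mathbb{C}$, and $\widehat{\mathbb{C}}$ the Riemann sphere. For a Jordan curve $\Gamma\subset\mathbb{C}$, let $\Omega$ and $\Omega^*$ be the bounded and unbounded components of $\widehat{\mathbb{C}}\setminus\Gamma$ (so $\infty\in\Omega^*$). $A(\Omega)$ is the space of continuous functions on $\overline{\Omega}$ that are analytic in $\Omega$; $A(\Omega^* )$ is the space of continuous functions on $\overline{\Omega^*}$ (closure in $\widehat{\mathbb{C}}$) that are analytic in $\Omega^*$ and vanish at $\infty$. The curve $\Gamma$ is called MP-solvable if there exist non-constant functions $f\in A(\Omega)$ and $g\in A(\Omega^* )$ such that $f=\overline{g}$ on $\Gamma$ (complex conjugate). *)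

theory Defs
  imports "HOL-Complex_Analysis.Complex_Analysis"
begin

definition Jordan_curve_set :: "complex set \<Rightarrow> bool" where
  "Jordan_curve_set \<Gamma> \<longleftrightarrow>
     (\<exists>\<gamma>. simple_path \<gamma> \<and> pathfinish \<gamma> = pathstart \<gamma> \<and> path_image \<gamma> = \<Gamma>)"

(* Meaningful for nonempty bounded sets, in particular for nonempty compact ones. *)
definition Hausdorff_dist :: "'a::metric_space set \<Rightarrow> 'a set \<Rightarrow> real" where
  "Hausdorff_dist S T = max (SUP x\<in>S. infdist x T) (SUP y\<in>T. infdist y S)"

(* The point at infinity is None. *)
definition Riemann_sphere :: "complex option topology" where
  "Riemann_sphere = Alexandroff_compactification euclidean"

definition chart_at_infinity :: "complex \<Rightarrow> complex option" where
  "chart_at_infinity w = (if w = 0 then None else Some (1 / w))"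

(* Analyticity on a subset of the sphere, read in the two standard charts. *)
definition sphere_analytic_on :: "(complex option \<Rightarrow> complex) \<Rightarrow> complex option set \<Rightarrow> bool" where
  "sphere_analytic_on g U \<longleftrightarrow>
     (g \<circ> Some) analytic_on (Some -` U) \<and>
     (g \<circ> chart_at_infinity) analytic_on (chart_at_infinity -` U)"

(* For a Jordan curve, inside and outside are the bounded and the unbounded component of
   its complement in the plane; the latter together with infinity is the component of the
   complement in the sphere that contains infinity. *)
definition int_domain :: "complex set \<Rightarrow> complex set" where
  "int_domain \<Gamma> = inside \<Gamma>"

definition ext_domain :: "complex set \<Rightarrow> complex option set" where
  "ext_domain \<Gamma> = insert None (Some ` outside \<Gamma>)"

(* Members of the two function spaces are represented by total functions; their values
   off the closure of the respective domain are irrelevant. *)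
definition A_int :: "complex set \<Rightarrow> (complex \<Rightarrow> complex) set" where
  "A_int \<Gamma> = {f. continuous_on (closure (int_domain \<Gamma>)) f \<and> f analytic_on int_domain \<Gamma>}"

definition A_ext :: "complex set \<Rightarrow> (complex option \<Rightarrow> complex) set" where
  "A_ext \<Gamma> =
     {g. continuous_map
           (subtopology Riemann_sphere (Riemann_sphere closure_of ext_domain \<Gamma>)) euclidean g \<and>
         sphere_analytic_on g (ext_domain \<Gamma>) \<and> g None = 0}"

definition MP_solvable :: "complex set \<Rightarrow> bool" where
  "MP_solvable \<Gamma> \<longleftrightarrow>
     (\<exists>f \<in> A_int \<Gamma>. \<exists>g \<in> A_ext \<Gamma>.
        \<not> f constant_on closure (int_domain \<Gamma>) \<and>
        \<not> g constant_on (Riemann_sphere closure_of ext_domain \<Gamma>) \<and>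
        (\<forall>z\<in>\<Gamma>. f z = cnj (g (Some z))))"

end

theory Submission
  imports Defs
begin

text \<open>
  A curve that contains a segment of its upper and a segment of its lower horizontal support line
  is not MP-solvable. Reflecting \<open>g\<close> in the upper support line extends \<open>f\<close> to the half-plane
  below that line, with limit \<open>0\<close> at infinity, and the lower line is treated alike. The two
  extensions glue to an entire function that tends to \<open>0\<close>, so \<open>f = 0\<close>. Any Jordan curve acquires
  such segments after a small change near its highest and its lowest point.

  For the solvable curve let \<open>\<psi>\<close> map the unit disc conformally onto the inside of \<open>\<Gamma>\<close> and put
  \<open>R z = (z - \<psi> 0) ^ n / (\<Prod>j<n. z - \<psi> (v j))\<close>, where \<open>v j\<close> are the \<open>n\<close>-th roots of \<open>r ^ n\<close>.
  For large \<open>n\<close> a suitable multiple of \<open>R \<circ> \<psi>\<close> is the \<open>n\<close>-th power of a map close to the identity.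
  Hence \<open>R\<close> has constant modulus on a Jordan curve close to \<open>\<psi> ` sphere 0 \<rho>\<close>, and there \<open>R\<close> and a
  multiple of \<open>1 / R\<close> are complex conjugates of each other. Subtracting the value of that multiple at
  infinity, which is real, from both functions gives a solution.
\<close>

section \<open>Jordan curves and the Riemann sphere\<close>

lemma Hausdorff_dist_le:
  assumes "S \<noteq> {}" "T \<noteq> {}" "\<And>x. x \<in> S \<Longrightarrow> \<exists>y\<in>T. dist x y \<le> e" "\<And>y. y \<in> T \<Longrightarrow> \<exists>x\<in>S. dist y x \<le> e"
  shows "Hausdorff_dist S T \<le> e"
  unfolding Hausdorff_dist_def
  by (intro max.boundedI cSUP_least assms) (use assms(3,4) infdist_le2 in metis)+

lemma Jordan_curve_set_props:
  assumes "Jordan_curve_set \<Gamma>"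
  shows "compact \<Gamma>" "\<Gamma> \<noteq> {}" "open (inside \<Gamma>)" "connected (inside \<Gamma>)" "inside \<Gamma> \<noteq> {}" "bounded (inside \<Gamma>)"
    "open (outside \<Gamma>)" "connected (outside \<Gamma>)" "inside \<Gamma> \<union> outside \<Gamma> = - \<Gamma>"
    "frontier (inside \<Gamma>) = \<Gamma>" "frontier (outside \<Gamma>) = \<Gamma>" "simply_connected (inside \<Gamma>)"
proof -
  obtain c where c: "simple_path c" "pathfinish c = pathstart c" "path_image c = \<Gamma>"
    using assms by (auto simp: Jordan_curve_set_def)
  show "compact \<Gamma>" "\<Gamma> \<noteq> {}" "simply_connected (inside \<Gamma>)"
    using c simply_connected_inside_simple_path[of c] by (auto simp: compact_simple_path_image)
qed (use assms Jordan_inside_outside in \<open>auto simp: Jordan_curve_set_def\<close>)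

lemma openin_Riemann_sphere_Some: "open U \<Longrightarrow> openin Riemann_sphere (Some ` U)"
  by (auto simp: Riemann_sphere_def openin_Alexandroff_compactification)

lemma openin_Riemann_sphere_infinity: "openin Riemann_sphere (insert None (Some ` (- cball 0 B)))"
  unfolding Riemann_sphere_def openin_Alexandroff_compactification
  by (intro disjI2 exI[of _ "cball 0 B"]) (simp add: Compl_eq_Diff_UNIV)

lemma topspace_Riemann_sphere [simp]: "topspace Riemann_sphere = UNIV"
  by (auto simp: Riemann_sphere_def UNIV_option_conv)

text \<open>Applied with \<open>U\<close> the inside of the curve: the closure in the sphere then
  avoids every inside point, so a function with a pole there can still be continuous on that
  closure.\<close>

lemma closure_of_ext_domain_subset:
  assumes "open U" "U \<inter> outside \<Gamma> = {}"
  shows "Riemann_sphere closure_of ext_domain \<Gamma> \<subseteq> - Some ` U"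
proof (rule closure_of_minimal)
  show "ext_domain \<Gamma> \<subseteq> - Some ` U" using assms(2) by (auto simp: ext_domain_def)
  show "closedin Riemann_sphere (- Some ` U)"
    using openin_Riemann_sphere_Some[OF assms(1)] by (simp add: closedin_def Compl_eq_Diff_UNIV[symmetric])
qed

text \<open>Up to intersection with \<open>S\<close>, a preimage of an open set is an open plane
  set, joined to a neighbourhood of infinity exactly when the target contains \<open>g None\<close>.
  The limit at infinity supplies that neighbourhood.\<close>

lemma continuous_map_Riemann_sphere:
  fixes g :: "complex option \<Rightarrow> complex"
  assumes "open V" "continuous_on V (\<lambda>z. g (Some z))" "((\<lambda>z. g (Some z)) \<longlongrightarrow> g None) at_infinity"
    and S: "\<And>z. Some z \<in> S \<Longrightarrow> z \<in> V"
  shows "continuous_map (subtopology Riemann_sphere S) euclidean g"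
proof -
  have "openin (subtopology Riemann_sphere S) {x \<in> S. g x \<in> T}" if "open T" for T
  proof -
    define P where "P = Some ` {z \<in> V. g (Some z) \<in> T}"
    have "open {z \<in> V. g (Some z) \<in> T}"
      using continuous_open_preimage[OF assms(2,1) that] by (simp add: vimage_def Int_def)
    then have P: "openin Riemann_sphere P"
      unfolding P_def by (rule openin_Riemann_sphere_Some)
    show ?thesis
    proof (cases "g None \<in> T")
      case False
      have "{x \<in> S. g x \<in> T} = P \<inter> S"
      proof (intro set_eqI)
        fix x show "x \<in> {x \<in> S. g x \<in> T} \<longleftrightarrow> x \<in> P \<inter> S"
          using False S by (cases x) (auto simp: P_def)
      qed
      then show ?thesis using openin_subtopology_Int[OF P] by simp
    next
      case True
      then have "\<forall>\<^sub>F z in at_infinity. g (Some z) \<in> T"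
        using assms(3) that topological_tendstoD by blast
      then obtain B where B: "\<And>z. norm z \<ge> B \<Longrightarrow> g (Some z) \<in> T"
        by (auto simp: eventually_at_infinity)
      let ?Q = "insert None (Some ` (- cball 0 B))"
      have "{x \<in> S. g x \<in> T} = (P \<union> ?Q) \<inter> S"
      proof (intro set_eqI)
        fix x show "x \<in> {x \<in> S. g x \<in> T} \<longleftrightarrow> x \<in> (P \<union> ?Q) \<inter> S"
          using True S B by (cases x) (auto simp: P_def)
      qed
      then show ?thesis using openin_subtopology_Int[OF openin_Un[OF P openin_Riemann_sphere_infinity]] by simp
    qed
  qed
  then show ?thesis by (auto simp: continuous_map_def)
qed

lemma continuous_map_Some_Riemann_sphere: "continuous_map euclidean Riemann_sphere Some"
  unfolding continuous_map_def
proof (intro conjI allI impI)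
  fix U assume "openin Riemann_sphere U"
  then have "open (Some -` U)"
    unfolding Riemann_sphere_def openin_Alexandroff_compactification
  proof (elim disjE exE conjE)
    fix V assume "openin euclidean V" "U = Some ` V"
    then show ?thesis by (simp add: inj_vimage_image_eq)
  next
    fix C assume C: "closedin euclidean C" "U = insert None (Some ` (topspace euclidean - C))"
    then have "Some -` U = - C" by auto
    then show ?thesis using C(1) by (simp add: open_Compl)
  qed
  then show "openin euclidean {x \<in> topspace euclidean. Some x \<in> U}"
    by (simp add: vimage_def)
qed simp

lemma closure_outside_ext_domain: "Some ` closure (outside \<Gamma>) \<subseteq> Riemann_sphere closure_of ext_domain \<Gamma>"
proof -
  have "Some ` closure (outside \<Gamma>) \<subseteq> Riemann_sphere closure_of (Some ` outside \<Gamma>)"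
    using continuous_map_image_closure_subset[OF continuous_map_Some_Riemann_sphere, of "outside \<Gamma>"] by simp
  also have "\<dots> \<subseteq> Riemann_sphere closure_of ext_domain \<Gamma>"
    by (rule closure_of_mono) (auto simp: ext_domain_def)
  finally show ?thesis .
qed

text \<open>This moves membership in \<open>A_ext\<close> to the plane, where the reflection
  argument takes place. Analyticity in the chart at infinity gives continuity there, which turns
  \<open>g None = 0\<close> into a limit.\<close>

lemma A_ext_plane:
  assumes g: "g \<in> A_ext \<Gamma>" and "open (outside \<Gamma>)"
  shows "continuous_on (closure (outside \<Gamma>)) (g \<circ> Some)" "(g \<circ> Some) holomorphic_on outside \<Gamma>"
    "((g \<circ> Some) \<longlongrightarrow> 0) at_infinity"
proof -
  have "continuous_map (top_of_set (closure (outside \<Gamma>)))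
      (subtopology Riemann_sphere (Riemann_sphere closure_of ext_domain \<Gamma>)) Some"
  proof (rule continuous_map_into_subtopology)
    show "continuous_map (top_of_set (closure (outside \<Gamma>))) Riemann_sphere Some"
      by (rule continuous_map_from_subtopology[OF continuous_map_Some_Riemann_sphere])
    show "Some \<in> topspace (top_of_set (closure (outside \<Gamma>))) \<rightarrow> Riemann_sphere closure_of ext_domain \<Gamma>"
      by (intro Pi_I subsetD[OF closure_outside_ext_domain] imageI) simp
  qed
  then have "continuous_map (top_of_set (closure (outside \<Gamma>))) euclidean (g \<circ> Some)"
    by (rule continuous_map_compose) (use g in \<open>simp add: A_ext_def\<close>)
  then show "continuous_on (closure (outside \<Gamma>)) (g \<circ> Some)" by simp
  have an: "(g \<circ> Some) analytic_on (Some -` ext_domain \<Gamma>)"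
    "(g \<circ> chart_at_infinity) analytic_on (chart_at_infinity -` ext_domain \<Gamma>)" "g None = 0"
    using g by (auto simp: A_ext_def sphere_analytic_on_def)
  have "Some -` ext_domain \<Gamma> = outside \<Gamma>" by (auto simp: ext_domain_def)
  then show "(g \<circ> Some) holomorphic_on outside \<Gamma>" using an(1) analytic_imp_holomorphic by metis
  have "(g \<circ> chart_at_infinity) analytic_on {0}"
    by (rule analytic_on_subset[OF an(2)]) (simp add: chart_at_infinity_def ext_domain_def)
  then have "isCont (g \<circ> chart_at_infinity) 0" by (rule analytic_at_imp_isCont)
  then have "((g \<circ> chart_at_infinity) \<longlongrightarrow> 0) (at 0)"
    using an(3) by (simp add: isCont_def chart_at_infinity_def)
  then have "(((g \<circ> Some) \<circ> inverse) \<longlongrightarrow> 0) (at 0)"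
    by (rule Lim_transform_eventually) (auto simp: eventually_at_filter chart_at_infinity_def field_simps)
  then show "((g \<circ> Some) \<longlongrightarrow> 0) at_infinity" by (simp add: lim_at_infinity_0)
qed

section \<open>Curves with two flat sides\<close>

text \<open>The reflected function \<open>\<lambda>z. cnj (G (\<sigma> z))\<close> is holomorphic on
  the whole half-plane, because the open half-plane beyond the support line lies outside the curve.
  On the flat segment it equals \<open>f\<close>, since \<open>\<sigma>\<close> fixes the line, and
  this forces equality on all of the inside. The sign \<open>s\<close> covers the upper and the
  lower support line at once.\<close>

lemma reflected_extension:
  fixes s :: real
  assumes \<Gamma>: "Jordan_curve_set \<Gamma>" and s: "s = 1 \<or> s = -1"
    and top: "\<And>z. z \<in> \<Gamma> \<Longrightarrow> s * Im z \<le> s * Im m" and "r > 0"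
    and flat: "\<And>z. z \<in> ball m r \<Longrightarrow> z \<in> \<Gamma> \<longleftrightarrow> s * Im z = s * Im m"
    and f: "continuous_on (closure (inside \<Gamma>)) f" "f holomorphic_on inside \<Gamma>"
    and G: "continuous_on (closure (outside \<Gamma>)) G" "G holomorphic_on outside \<Gamma>" "(G \<longlongrightarrow> 0) at_infinity"
    and match: "\<And>z. z \<in> \<Gamma> \<Longrightarrow> f z = cnj (G z)"
  obtains F where "F holomorphic_on {z. s * Im z < s * Im m}" "\<And>z. z \<in> inside \<Gamma> \<Longrightarrow> s * Im z < s * Im m"
    "\<And>z. z \<in> inside \<Gamma> \<Longrightarrow> F z = f z"
    "\<And>e. e > 0 \<Longrightarrow> \<exists>B. \<forall>z. s * Im z < s * Im m \<longrightarrow> B \<le> norm z \<longrightarrow> norm (F z) < e"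
proof -
  note J = Jordan_curve_set_props[OF \<Gamma>]
  \<comment> \<open>The unit normal pointing across the support line. The line becomes
    \<open>d \<bullet> z = a\<close>, the form needed for pasting across it.\<close>
  define d where "d = Complex 0 s"
  define a where "a = s * Im m"
  have d: "d \<bullet> z = s * Im z" for z by (simp add: d_def inner_complex_def)
  have "d \<noteq> 0" using s by (auto simp: d_def complex_eq_iff)
  have ss: "s * s = 1" using s by auto
  \<comment> \<open>Reflection in the support line, which is \<open>Im z = s * a\<close> because
    \<open>s * s = 1\<close>.\<close>
  define \<sigma> where "\<sigma> = (\<lambda>z. cnj z + 2 * \<i> * of_real (s * a))"
  have \<sigma>: "d \<bullet> \<sigma> z = 2 * a - d \<bullet> z" for z
    using ss by (simp add: d \<sigma>_def algebra_simps)
  have \<sigma>_fix: "\<sigma> z = z" if "d \<bullet> z = a" for z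
    using that s by (auto simp: \<sigma>_def d complex_eq_iff)
  have \<sigma>_norm: "norm z \<le> norm (\<sigma> z) + 2 * \<bar>a\<bar>" for z
  proof -
    have "cnj z = \<sigma> z - 2 * \<i> * of_real (s * a)" by (simp add: \<sigma>_def)
    then have "norm z \<le> norm (\<sigma> z) + norm (2 * \<i> * of_real (s * a))"
      by (metis complex_mod_cnj norm_triangle_ineq4)
    also have "norm (2 * \<i> * complex_of_real (s * a)) = 2 * \<bar>a\<bar>"
      using s by (auto simp: norm_mult)
    finally show ?thesis .
  qed
  have "\<Gamma> \<subseteq> {z. d \<bullet> z \<le> a}" using top by (auto simp: d a_def)
  then have "- {z. d \<bullet> z \<le> a} \<subseteq> outside \<Gamma>"
    by (rule outside_subset_convex[OF convex_halfspace_le])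
  then have out: "{z. a < d \<bullet> z} \<subseteq> outside \<Gamma>" by auto
  have "inside \<Gamma> \<subseteq> {z. d \<bullet> z \<le> a}"
  proof
    fix z assume "z \<in> inside \<Gamma>"
    then have "z \<notin> outside \<Gamma>" using inside_Int_outside by blast
    then show "z \<in> {z. d \<bullet> z \<le> a}" using out by force
  qed
  \<comment> \<open>Openness of the inside makes the inequality strict.\<close>
  then have in_lt: "inside \<Gamma> \<subseteq> {z. d \<bullet> z < a}"
    using interior_maximal[OF _ J(3), of "{z. d \<bullet> z \<le> a}"] interior_halfspace_le[OF \<open>d \<noteq> 0\<close>, of a] by simp
  have out_le: "{z. a \<le> d \<bullet> z} \<subseteq> closure (outside \<Gamma>)"
    using closure_mono[OF out] \<open>d \<noteq> 0\<close> by simp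
  define F where "F = (\<lambda>z. cnj (G (\<sigma> z)))"
  have F: "F holomorphic_on {z. d \<bullet> z < a}"
  proof -
    let ?h = "\<lambda>w. G (w + 2 * \<i> * of_real (s * a))"
    have sub: "(\<lambda>w. w + 2 * \<i> * of_real (s * a)) ` cnj ` {z. d \<bullet> z < a} \<subseteq> outside \<Gamma>"
      using out \<sigma> by (auto simp: \<sigma>_def subset_iff)
    have "(G \<circ> (\<lambda>w. w + 2 * \<i> * of_real (s * a))) holomorphic_on cnj ` {z. d \<bullet> z < a}"
      by (rule holomorphic_on_compose_gen[OF _ G(2) sub]) (intro holomorphic_intros)
    then have "?h holomorphic_on cnj ` {z. d \<bullet> z < a}" by (simp add: o_def)
    then have "cnj \<circ> ?h \<circ> cnj holomorphic_on {z. d \<bullet> z < a}"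
      by (rule holomorphic_on_compose_cnj_cnj) (rule open_halfspace_lt)
    then show ?thesis by (simp add: F_def \<sigma>_def o_def)
  qed
  have Fc: "continuous_on {z. d \<bullet> z \<le> a} F"
    unfolding F_def
  proof (intro continuous_intros continuous_on_compose2[OF G(1)])
    show "continuous_on {z. d \<bullet> z \<le> a} \<sigma>" unfolding \<sigma>_def by (intro continuous_intros)
    show "\<sigma> ` {z. d \<bullet> z \<le> a} \<subseteq> closure (outside \<Gamma>)"
    proof (intro subset_trans[OF _ out_le] image_subsetI CollectI)
      fix z assume "z \<in> {z. d \<bullet> z \<le> a}"
      then show "a \<le> d \<bullet> \<sigma> z" using \<sigma>[of z] by simp
    qed
  qed
  let ?B = "ball m r"
  define L where "L = ?B \<inter> {z. d \<bullet> z < a}"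
  have L: "open L" "connected L"
    by (auto simp: L_def intro!: open_Int open_halfspace_lt convex_connected convex_Int convex_halfspace_lt)
  have m: "m \<in> \<Gamma>" using flat[of m] \<open>r > 0\<close> by simp
  have L_in: "L \<inter> inside \<Gamma> \<noteq> {}"
  proof -
    have "m \<in> ?B \<inter> closure (inside \<Gamma>)"
      using m J(10) \<open>r > 0\<close> by (auto simp: frontier_def)
    then have "?B \<inter> inside \<Gamma> \<noteq> {}"
      using open_Int_closure_eq_empty[OF open_ball, of m r "inside \<Gamma>"] by blast
    then show ?thesis using in_lt by (auto simp: L_def)
  qed
  \<comment> \<open>The half-disc \<open>L\<close> is connected, misses the curve and meets the
    inside, so it lies in the inside.\<close>
  have "L \<inter> \<Gamma> = {}" using flat by (auto simp: L_def d a_def)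
  then have "L \<subseteq> inside \<Gamma> \<union> outside \<Gamma>" using J(9) by blast
  then have "L \<subseteq> inside \<Gamma>"
    using connectedD[OF L(2) J(3,7)] L_in inside_Int_outside by blast
  have flatB: "z \<in> \<Gamma>" if "z \<in> ?B" "d \<bullet> z = a" for z
    using flat[of z] that by (simp add: d a_def)
  txt \<open>Pasting \<open>f - F\<close> with \<open>0\<close> across the segment gives a holomorphic function, which vanishes on the
    far side of the segment and hence everywhere.\<close>
  define D where "D = (\<lambda>z. if d \<bullet> z \<le> a then f z - F z else 0)"
  have "D holomorphic_on ?B"
  proof (rule holomorphic_on_paste_across_line[OF open_ball \<open>d \<noteq> 0\<close>])
    have "(\<lambda>z. f z - F z) holomorphic_on ?B \<inter> {z. d \<bullet> z < a}"
      using f(2) F \<open>L \<subseteq> inside \<Gamma>\<close> by (intro holomorphic_intros) (auto simp: L_def elim!: holomorphic_on_subset)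
    then show "D holomorphic_on ?B \<inter> {z. d \<bullet> z < a}"
      by (rule holomorphic_transform) (auto simp: D_def)
    show "D holomorphic_on ?B \<inter> {z. a < d \<bullet> z}"
      by (rule holomorphic_transform[of "\<lambda>_. 0"]) (auto simp: D_def)
    have "{z \<in> ?B. d \<bullet> z \<le> a} \<subseteq> closure (inside \<Gamma>)"
    proof
      fix z assume z: "z \<in> {z \<in> ?B. d \<bullet> z \<le> a}"
      show "z \<in> closure (inside \<Gamma>)"
      proof (cases "d \<bullet> z = a")
        case True
        then show ?thesis using flatB[of z] z J(10) by (auto simp: frontier_def)
      next
        case False
        then have "z \<in> L" using z by (auto simp: L_def)
        then show ?thesis using \<open>L \<subseteq> inside \<Gamma>\<close> closure_subset by blast
      qed
    qed
    then show "continuous_on ?B D"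
      unfolding D_def
      using f(1) Fc flatB match \<sigma>_fix
      by (intro continuous_on_cases_le continuous_intros) (auto simp: F_def elim!: continuous_on_subset)
  qed
  \<comment> \<open>A witness that the half of the disc where \<open>D\<close> is zero by definition
    is nonempty, as the identity theorem requires.\<close>
  moreover have "m + of_real (r / 2) * d \<in> ?B \<inter> {z. a < d \<bullet> z}"
  proof -
    have "d \<bullet> (m + of_real (r / 2) * d) = a + r / 2" unfolding d using s by (auto simp: d_def a_def)
    moreover have "norm d = 1" using s by (auto simp: d_def cmod_def)
    ultimately show ?thesis using \<open>r > 0\<close> by (simp add: dist_norm norm_mult)
  qed
  ultimately have "D z = 0" if "z \<in> ?B" for z
    using that by (intro analytic_continuation_open[of "?B \<inter> {z. a < d \<bullet> z}" ?B D "\<lambda>_. 0" z] open_Int open_halfspace_gt)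
                  (auto simp: D_def)
  then have L_eq: "f z = F z" if "z \<in> L" for z using that unfolding L_def D_def by force
  have eq: "f z = F z" if "z \<in> inside \<Gamma>" for z
  proof (rule analytic_continuation_open[of L "inside \<Gamma>" f F z])
    show "L \<noteq> {}" using L_in by blast
    show "F holomorphic_on inside \<Gamma>" using F in_lt by (rule holomorphic_on_subset)
  qed (use that L_eq L(1) J(3,4) \<open>L \<subseteq> inside \<Gamma>\<close> f(2) in auto)
  show ?thesis
  proof (rule that[of F])
    show "F holomorphic_on {z. s * Im z < s * Im m}" using F by (simp add: d a_def)
    show "s * Im z < s * Im m" "F z = f z" if "z \<in> inside \<Gamma>" for z
      using that in_lt eq by (auto simp: d a_def)
    fix e :: real assume "e > 0"
    then obtain B where B: "\<And>z. norm z \<ge> B \<Longrightarrow> norm (G z) < e"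
      using G(3) by (auto simp: Lim_at_infinity)
    \<comment> \<open>Reflection decreases the modulus by at most \<open>2 * \<bar>a\<bar>\<close>,
      hence the shifted threshold.\<close>
    have "norm (F z) < e" if "B + 2 * \<bar>a\<bar> \<le> norm z" for z
      using that B[of "\<sigma> z"] \<sigma>_norm[of z] by (simp add: F_def)
    then show "\<exists>B. \<forall>z. s * Im z < s * Im m \<longrightarrow> B \<le> norm z \<longrightarrow> norm (F z) < e" by blast
  qed
qed

lemma two_flat_sides_not_MP_solvable:
  assumes \<Gamma>: "Jordan_curve_set \<Gamma>"
    and top: "\<And>z. z \<in> \<Gamma> \<Longrightarrow> Im z \<le> Im m" "r > 0" "\<And>z. z \<in> ball m r \<Longrightarrow> z \<in> \<Gamma> \<longleftrightarrow> Im z = Im m"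
    and bot: "\<And>z. z \<in> \<Gamma> \<Longrightarrow> Im m' \<le> Im z" "r' > 0" "\<And>z. z \<in> ball m' r' \<Longrightarrow> z \<in> \<Gamma> \<longleftrightarrow> Im z = Im m'"
  shows "\<not> MP_solvable \<Gamma>"
proof
  note J = Jordan_curve_set_props[OF \<Gamma>]
  assume "MP_solvable \<Gamma>"
  then obtain f g where f: "f \<in> A_int \<Gamma>" and g: "g \<in> A_ext \<Gamma>"
    and nc: "\<not> f constant_on closure (inside \<Gamma>)" and fg: "\<forall>z\<in>\<Gamma>. f z = cnj (g (Some z))"
    unfolding MP_solvable_def int_domain_def by blast
  then have match: "f z = cnj ((g \<circ> Some) z)" if "z \<in> \<Gamma>" for z using that by simp
  have f': "continuous_on (closure (inside \<Gamma>)) f" "f holomorphic_on inside \<Gamma>"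
    using f J(3) by (auto simp: A_int_def int_domain_def analytic_on_open)
  note G = A_ext_plane[OF g J(7)]
  obtain F1 where F1: "F1 holomorphic_on {z. Im z < Im m}" "\<And>z. z \<in> inside \<Gamma> \<Longrightarrow> Im z < Im m"
    "\<And>z. z \<in> inside \<Gamma> \<Longrightarrow> F1 z = f z"
    "\<And>e. e > 0 \<Longrightarrow> \<exists>B. \<forall>z. Im z < Im m \<longrightarrow> B \<le> norm z \<longrightarrow> norm (F1 z) < e"
    by (rule reflected_extension[OF \<Gamma>, of 1 m r f "g \<circ> Some"]) (use top f' G match in auto)
  obtain F2 where F2: "F2 holomorphic_on {z. Im m' < Im z}" "\<And>z. z \<in> inside \<Gamma> \<Longrightarrow> Im m' < Im z"
    "\<And>z. z \<in> inside \<Gamma> \<Longrightarrow> F2 z = f z"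
    "\<And>e. e > 0 \<Longrightarrow> \<exists>B. \<forall>z. Im m' < Im z \<longrightarrow> B \<le> norm z \<longrightarrow> norm (F2 z) < e"
    by (rule reflected_extension[OF \<Gamma>, of "-1" m' r' f "g \<circ> Some"]) (use bot f' G match in auto)
  have opn: "open {z. Im z < Im m}" "open {z. Im m' < Im z}"
    by (rule open_halfspace_Im_lt open_halfspace_Im_gt)+
  obtain w where "w \<in> inside \<Gamma>" using J(5) by blast
  then have mm: "Im m' < Im m" using F1(2) F2(2) by force
  \<comment> \<open>The strip between the two support lines is connected and contains the inside,
    where both extensions equal \<open>f\<close>; the identity theorem applies.\<close>
  have F12: "F1 z = F2 z" if "Im z < Im m" "Im m' < Im z" for z
  proof (rule analytic_continuation_open[of "inside \<Gamma>" "{z. Im z < Im m} \<inter> {z. Im m' < Im z}" F1 F2])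
    show "connected ({z. Im z < Im m} \<inter> {z. Im m' < Im z})"
      by (intro convex_connected convex_Int convex_halfspace_Im_lt convex_halfspace_Im_gt)
    show "F1 holomorphic_on {z. Im z < Im m} \<inter> {z. Im m' < Im z}"
      "F2 holomorphic_on {z. Im z < Im m} \<inter> {z. Im m' < Im z}"
      using F1(1) F2(1) by (auto elim!: holomorphic_on_subset)
  qed (use that J(3,5) F1(2,3) F2(2,3) opn in auto)
  define F where "F = (\<lambda>z. if Im z < Im m then F1 z else F2 z)"
  have FF: "F z = F1 z" if "Im z < Im m" for z using that by (simp add: F_def)
  have FF2: "F z = F2 z" if "Im m' < Im z" for z using that F12 by (simp add: F_def)
  have "F holomorphic_on {z. Im z < Im m} \<union> {z. Im m' < Im z}"
  proof (rule holomorphic_on_Un[OF _ _ opn])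
    show "F holomorphic_on {z. Im z < Im m}" by (rule holomorphic_transform[OF F1(1)]) (simp add: FF)
    show "F holomorphic_on {z. Im m' < Im z}" by (rule holomorphic_transform[OF F2(1)]) (simp add: FF2)
  qed
  moreover have "{z. Im z < Im m} \<union> {z. Im m' < Im z} = UNIV" using mm by auto
  moreover have "(F \<longlongrightarrow> 0) at_infinity"
    unfolding Lim_at_infinity
  proof (intro allI impI)
    fix e :: real assume "e > 0"
    obtain B1 B2 where "\<And>z. Im z < Im m \<Longrightarrow> B1 \<le> norm z \<Longrightarrow> norm (F1 z) < e"
      "\<And>z. Im m' < Im z \<Longrightarrow> B2 \<le> norm z \<Longrightarrow> norm (F2 z) < e"
      using F1(4)[OF \<open>e > 0\<close>] F2(4)[OF \<open>e > 0\<close>] by metis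
    then show "\<exists>B. \<forall>z. B \<le> norm z \<longrightarrow> dist (F z) 0 < e"
      using mm by (intro exI[of _ "max B1 B2"]) (auto simp: F_def)
  qed
  ultimately have "F z = 0" for z by (intro Liouville_weak_0) auto
  then have "f z = 0" if "z \<in> inside \<Gamma>" for z
    using F1(2,3)[OF that] FF[of z] by metis
  then have "f z = 0" if "z \<in> closure (inside \<Gamma>)" for z
    using continuous_constant_on_closure[OF f'(1) _ that] by blast
  then show False using nc by (auto simp: constant_on_def)
qed

text \<open>The point \<open>q\<close> is the extremal point of \<open>\<Gamma>\<close> on a vertical line close to \<open>p\<close>, so the vertical ray
  from \<open>q\<close> away from \<open>\<Gamma>\<close> meets \<open>\<Gamma>\<close> only in \<open>q\<close>.\<close>

lemma extremal_cut:
  fixes s :: real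
  assumes \<Gamma>: "Jordan_curve_set \<Gamma>" and s: "s = 1 \<or> s = -1" and "e > 0"
  obtains p q c where "p \<in> \<Gamma>" "\<And>z. z \<in> \<Gamma> \<Longrightarrow> s * Im z \<le> s * Im p" "q \<in> \<Gamma>" "Re q \<noteq> Re p" "dist p q < e"
    "\<And>z. z \<in> \<Gamma> \<Longrightarrow> Re z = Re q \<Longrightarrow> s * Im z \<le> s * Im q"
    "arc c" "pathstart c = q" "pathfinish c = p" "path_image c \<subseteq> \<Gamma>" "\<Gamma> - path_image c \<subseteq> ball p e"
proof -
  note J = Jordan_curve_set_props[OF \<Gamma>]
  obtain c0 where c0: "simple_path c0" "pathfinish c0 = pathstart c0" "path_image c0 = \<Gamma>"
    using \<Gamma> by (auto simp: Jordan_curve_set_def)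
  have height: "continuous_on A (\<lambda>z. s * Im z)" for A by (intro continuous_intros)
  obtain p where p: "p \<in> \<Gamma>" "\<And>z. z \<in> \<Gamma> \<Longrightarrow> s * Im z \<le> s * Im p"
    using continuous_attains_sup[OF J(1,2) height] by blast
  obtain t0 where t0: "t0 \<in> {0..1}" "p = c0 t0" using p(1) c0(3) by (auto simp: path_image_def)
  \<comment> \<open>Reparametrised to start and end at the extremal point \<open>p\<close>, so that
    the two ends of the parameter interval describe the curve near \<open>p\<close>.\<close>
  define \<gamma> where "\<gamma> = shiftpath t0 c0"
  have \<gamma>: "simple_path \<gamma>" "path_image \<gamma> = \<Gamma>" "\<gamma> 0 = p" "\<gamma> 1 = p"
    using t0 c0 simple_path_shiftpath[OF c0(1,2)] endpoints_shiftpath[OF c0(2) t0(1)]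
    by (auto simp: \<gamma>_def path_image_shiftpath pathstart_def pathfinish_def)
  have cont: "continuous_on {0..1} \<gamma>" using \<gamma>(1) by (simp add: simple_path_def path_def)
  have lf: "x = y \<or> x = 0 \<and> y = 1 \<or> x = 1 \<and> y = 0" if "x \<in> {0..1}" "y \<in> {0..1}" "\<gamma> x = \<gamma> y" for x y
    using that \<gamma>(1) by (auto simp: simple_path_def loop_free_def)
  have in\<Gamma>: "\<gamma> t \<in> \<Gamma>" if "t \<in> {0..1}" for t using that \<gamma>(2) by (auto simp: path_image_def)
  have near: "\<exists>\<tau>>0. \<tau> < 1 / 2 \<and> (\<forall>t\<in>{0..1}. t \<le> \<tau> \<or> 1 - \<tau> \<le> t \<longrightarrow> dist p (\<gamma> t) < \<eta>)" if \<eta>: "\<eta> > 0" for \<eta>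
  proof -
    have "uniformly_continuous_on {0..1} \<gamma>" using cont by (intro compact_uniformly_continuous) auto
    then obtain \<delta> where \<delta>: "\<delta> > 0" "\<And>t t'. t \<in> {0..1} \<Longrightarrow> t' \<in> {0..1} \<Longrightarrow> dist t' t < \<delta> \<Longrightarrow> dist (\<gamma> t') (\<gamma> t) < \<eta>"
      unfolding uniformly_continuous_on_def using \<eta> by metis
    show ?thesis
    proof (intro exI[of _ "min (\<delta> / 2) (1 / 4)"] conjI ballI impI)
      fix t :: real assume t: "t \<in> {0..1}" "t \<le> min (\<delta> / 2) (1 / 4) \<or> 1 - min (\<delta> / 2) (1 / 4) \<le> t"
      then have "dist 0 t < \<delta> \<or> dist 1 t < \<delta>" using \<delta>(1) by (auto simp: dist_real_def)
      then show "dist p (\<gamma> t) < \<eta>" using \<delta>(2)[of t 0] \<delta>(2)[of t 1] t(1) \<gamma>(3,4) by auto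
    qed (use \<delta>(1) in auto)
  qed
  obtain \<tau> where \<tau>: "\<tau> > 0" "\<tau> < 1 / 2" "\<And>t. t \<in> {0..1} \<Longrightarrow> t \<le> \<tau> \<or> 1 - \<tau> \<le> t \<Longrightarrow> dist p (\<gamma> t) < e"
    using near[OF \<open>e > 0\<close>] by blast
  have "closed (\<gamma> ` {\<tau>..1 - \<tau>})"
    using \<tau> cont by (intro compact_imp_closed compact_continuous_image) (auto elim!: continuous_on_subset)
  moreover have "p \<notin> \<gamma> ` {\<tau>..1 - \<tau>}"
  proof
    assume "p \<in> \<gamma> ` {\<tau>..1 - \<tau>}"
    then obtain t where "t \<in> {\<tau>..1 - \<tau>}" "\<gamma> 0 = \<gamma> t" using \<gamma>(3) by auto
    then show False using lf[of 0 t] \<tau>(1,2) by auto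
  qed
  \<comment> \<open>The middle stretch keeps distance at least \<open>d\<close> from
    \<open>p\<close>, so a point of the curve closer than \<open>d\<close> has its parameter in one
    of the end stretches.\<close>
  ultimately obtain d where d: "d > 0" "\<And>t. t \<in> {\<tau>..1 - \<tau>} \<Longrightarrow> d \<le> dist p (\<gamma> t)"
    using separate_point_closed by (metis imageI)
  define \<eta> where "\<eta> = min d e"
  have "\<eta> / 2 > 0" using d \<open>e > 0\<close> by (simp add: \<eta>_def)
  \<comment> \<open>Half of \<open>\<eta>\<close>, since the real and the imaginary part of
    \<open>p - q\<close> are each estimated by this bound.\<close>
  then obtain \<tau>' where \<tau>': "\<tau>' > 0" "\<tau>' < 1 / 2" "\<And>t. t \<in> {0..1} \<Longrightarrow> t \<le> \<tau>' \<or> 1 - \<tau>' \<le> t \<Longrightarrow> dist p (\<gamma> t) < \<eta> / 2"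
    using near by blast
  \<comment> \<open>Otherwise both ends of the curve run along the vertical line through
    \<open>p\<close>. Since \<open>p\<close> is extremal, both leave it in the same direction, and
    the intermediate value theorem makes them meet, against injectivity.\<close>
  have "\<exists>t\<in>{0..1}. (t \<le> \<tau>' \<or> 1 - \<tau>' \<le> t) \<and> Re (\<gamma> t) \<noteq> Re p"
  proof (rule ccontr)
    assume "\<not> ?thesis"
    then have vert: "\<And>t. t \<in> {0..1} \<Longrightarrow> t \<le> \<tau>' \<or> 1 - \<tau>' \<le> t \<Longrightarrow> Re (\<gamma> t) = Re p" by blast
    define h where "h = (\<lambda>t. s * Im (\<gamma> t))"
    have h: "continuous_on {0..1} h" unfolding h_def using cont by (intro continuous_intros)
    have inj: "\<gamma> t = \<gamma> t'" if "h t = h t'" "Re (\<gamma> t) = Re (\<gamma> t')" for t t'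
      using that s by (auto simp: h_def complex_eq_iff)
    have less: "h t < s * Im p" if "t \<in> {0<..<1}" "t \<le> \<tau>' \<or> 1 - \<tau>' \<le> t" for t
    proof -
      have "h t \<le> h 0" using p(2) in\<Gamma>[of t] that \<gamma>(3) by (auto simp: h_def)
      moreover have "h t \<noteq> h 0"
        using inj[of t 0] vert[of t] vert[of 0] lf[of t 0] that \<tau>' by auto
      ultimately show ?thesis using \<gamma>(3) by (simp add: h_def order_less_le)
    qed
    \<comment> \<open>The larger of the values at the inner ends is attained by \<open>h\<close> on
      both stretches.\<close>
    define c where "c = max (h \<tau>') (h (1 - \<tau>'))"
    have c: "c < s * Im p" using less[of \<tau>'] less[of "1 - \<tau>'"] \<tau>' by (simp add: c_def)
    have ends: "h 0 = s * Im p" "h 1 = s * Im p" using \<gamma> by (auto simp: h_def)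
    obtain t1 where t1: "0 \<le> t1" "t1 \<le> \<tau>'" "h t1 = c"
      using IVT2'[of h \<tau>' c 0] continuous_on_subset[OF h, of "{0..\<tau>'}"] c ends \<tau>' by (auto simp: c_def)
    obtain t2 where t2: "1 - \<tau>' \<le> t2" "t2 \<le> 1" "h t2 = c"
      using IVT'[of h "1 - \<tau>'" c 1] continuous_on_subset[OF h, of "{1-\<tau>'..1}"] c ends \<tau>' by (auto simp: c_def)
    have "\<gamma> t1 = \<gamma> t2" using inj[of t1 t2] vert[of t1] vert[of t2] t1 t2 \<tau>' by auto
    then have "t1 = 0" using lf[of t1 t2] t1 t2 \<tau>' by auto
    then show False using t1(3) c ends by simp
  qed
  then obtain t where t: "t \<in> {0..1}" "t \<le> \<tau>' \<or> 1 - \<tau>' \<le> t" "Re (\<gamma> t) \<noteq> Re p" by blast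
  define X where "X = \<Gamma> \<inter> {z. Re z = Re (\<gamma> t)}"
  have "closed {z. Re z = Re (\<gamma> t)}" by (intro closed_Collect_eq continuous_intros)
  then have "compact X" unfolding X_def using J(1) by (rule compact_Int_closed[rotated])
  moreover have "X \<noteq> {}" using in\<Gamma>[OF t(1)] by (auto simp: X_def)
  ultimately obtain q where q: "q \<in> X" "\<And>z. z \<in> X \<Longrightarrow> s * Im z \<le> s * Im q"
    using continuous_attains_sup[of X "\<lambda>z. s * Im z", OF _ _ height] by blast
  have q\<Gamma>: "q \<in> \<Gamma>" "Re q = Re (\<gamma> t)" using q(1) by (auto simp: X_def)
  have pq: "dist p q < \<eta>"
  proof -
    have "\<bar>Re p - Re q\<bar> < \<eta> / 2"
      using \<tau>'(3)[OF t(1,2)] abs_Re_le_cmod[of "p - \<gamma> t"] q\<Gamma>(2) by (simp add: dist_norm)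
    \<comment> \<open>In height, \<open>q\<close> lies between \<open>\<gamma> t\<close> and
      \<open>p\<close>.\<close>
    moreover have "\<bar>Im p - Im q\<bar> < \<eta> / 2"
    proof -
      have "s * Im (\<gamma> t) \<le> s * Im q" using q(2) in\<Gamma>[OF t(1)] by (auto simp: X_def)
      moreover have "s * Im q \<le> s * Im p" using p(2) q\<Gamma>(1) by blast
      ultimately have "\<bar>Im p - Im q\<bar> \<le> \<bar>Im p - Im (\<gamma> t)\<bar>" using s by auto
      then show ?thesis
        using \<tau>'(3)[OF t(1,2)] abs_Im_le_cmod[of "p - \<gamma> t"] by (simp add: dist_norm)
    qed
    ultimately show ?thesis using cmod_le[of "p - q"] by (simp add: dist_norm)
  qed
  obtain t1 where t1: "t1 \<in> {0..1}" "q = \<gamma> t1" using q\<Gamma>(1) \<gamma>(2) by (auto simp: path_image_def)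
  have "t1 < \<tau> \<or> 1 - \<tau> < t1"
    using d(2)[of t1] pq t1(2) by (force simp: \<eta>_def)
  \<comment> \<open>Of the two arcs between \<open>q\<close> and \<open>p\<close>, the one kept
    contains the middle stretch, so what is discarded lies in an end stretch near \<open>p\<close>.
    If \<open>q\<close> is near parameter \<open>1\<close>, the kept arc runs backwards from
    \<open>t1\<close> to \<open>0\<close>.\<close>
  then have "\<exists>c. arc c \<and> pathstart c = q \<and> pathfinish c = p \<and> path_image c \<subseteq> \<Gamma> \<and> \<Gamma> - path_image c \<subseteq> ball p e"
  proof
    assume less: "t1 < \<tau>"
    show ?thesis
    proof (intro exI[of _ "subpath t1 1 \<gamma>"] conjI)
      show "arc (subpath t1 1 \<gamma>)"
        using \<gamma> t1 t(3) q\<Gamma>(2) by (intro arc_simple_path_subpath) auto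
      show "\<Gamma> - path_image (subpath t1 1 \<gamma>) \<subseteq> ball p e"
      proof
        fix z assume z: "z \<in> \<Gamma> - path_image (subpath t1 1 \<gamma>)"
        then obtain u where u: "u \<in> {0..1}" "z = \<gamma> u" using \<gamma>(2) by (auto simp: path_image_def)
        then have "u < t1" using z t1(1) by (force simp: path_image_subpath)
        then show "z \<in> ball p e" using \<tau>(3)[OF u(1)] less u(2) by simp
      qed
    qed (use t1 \<gamma> path_image_subpath_subset[of t1 1 \<gamma>] in auto)
  next
    assume less: "1 - \<tau> < t1"
    show ?thesis
    proof (intro exI[of _ "subpath t1 0 \<gamma>"] conjI)
      show "arc (subpath t1 0 \<gamma>)"
        using \<gamma> t1 t(3) q\<Gamma>(2) by (intro arc_simple_path_subpath) auto
      show "\<Gamma> - path_image (subpath t1 0 \<gamma>) \<subseteq> ball p e"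
      proof
        fix z assume z: "z \<in> \<Gamma> - path_image (subpath t1 0 \<gamma>)"
        then obtain u where u: "u \<in> {0..1}" "z = \<gamma> u" using \<gamma>(2) by (auto simp: path_image_def)
        moreover have "path_image (subpath t1 0 \<gamma>) = \<gamma> ` {0..t1}"
          using path_image_subpath_commute[of t1 0 \<gamma>] t1(1) by (simp add: path_image_subpath)
        ultimately have "u > t1" using z by force
        then show "z \<in> ball p e" using \<tau>(3)[OF u(1)] less u(2) by simp
      qed
    qed (use t1 \<gamma> path_image_subpath_subset[of t1 0 \<gamma>] in auto)
  qed
  then obtain c where c: "arc c" "pathstart c = q" "pathfinish c = p" "path_image c \<subseteq> \<Gamma>" "\<Gamma> - path_image c \<subseteq> ball p e"
    by blast
  show ?thesis
  proof (rule that[OF p q\<Gamma>(1) _ _ _ c])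
    show "s * Im z \<le> s * Im q" if "z \<in> \<Gamma>" "Re z = Re q" for z
      using that q(2)[of z] q\<Gamma>(2) by (simp add: X_def)
  qed (use t(3) q\<Gamma>(2) pq in \<open>auto simp: \<eta>_def\<close>)
qed

text \<open>The discarded arc between \<open>p\<close> and \<open>q\<close> is replaced by a cap
  with three sides: outward from \<open>p\<close>, across parallel to the support line, and back to
  \<open>q\<close>. Extremality of \<open>p\<close>, and of \<open>q\<close> on its vertical line,
  keeps the cap off the rest of the curve. The point \<open>m\<close> is the midpoint of the flat
  side.\<close>

lemma flatten_side:
  fixes s :: real
  assumes \<Gamma>: "Jordan_curve_set \<Gamma>" and s: "s = 1 \<or> s = -1" and "e > 0"
  obtains \<Gamma>1 m r p where "Jordan_curve_set \<Gamma>1" "r > 0" "\<And>z. z \<in> \<Gamma>1 \<Longrightarrow> s * Im z \<le> s * Im m"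
    "\<And>z. z \<in> ball m r \<Longrightarrow> z \<in> \<Gamma>1 \<longleftrightarrow> s * Im z = s * Im m"
    "p \<in> \<Gamma>" "p \<in> \<Gamma>1" "\<And>z. z \<in> \<Gamma> \<Longrightarrow> s * Im z \<le> s * Im p" "s * Im p < s * Im m"
    "\<Gamma> - ball p e \<subseteq> \<Gamma>1" "\<Gamma>1 - ball p e \<subseteq> \<Gamma>"
proof -
  have e4: "e / 4 > 0" using \<open>e > 0\<close> by simp
  obtain p q c where p: "p \<in> \<Gamma>" "\<And>z. z \<in> \<Gamma> \<Longrightarrow> s * Im z \<le> s * Im p"
    and q: "q \<in> \<Gamma>" "Re q \<noteq> Re p" "dist p q < e / 4" "\<And>z. z \<in> \<Gamma> \<Longrightarrow> Re z = Re q \<Longrightarrow> s * Im z \<le> s * Im q"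
    and c: "arc c" "pathstart c = q" "pathfinish c = p" "path_image c \<subseteq> \<Gamma>" "\<Gamma> - path_image c \<subseteq> ball p (e / 4)"
    using extremal_cut[OF \<Gamma> s e4] by metis
  \<comment> \<open>A quarter of \<open>e\<close> is small enough for the whole cap to stay in
    \<open>ball p e\<close>.\<close>
  define \<delta> where "\<delta> = e / 4"
  define p' where "p' = Complex (Re p) (Im p + s * \<delta>)"
  define q' where "q' = Complex (Re q) (Im p + s * \<delta>)"
  define m where "m = Complex ((Re p + Re q) / 2) (Im p + s * \<delta>)"
  define hw where "hw = \<bar>Re q - Re p\<bar> / 2"
  have pos: "\<delta> > 0" "hw > 0" using \<open>e > 0\<close> q(2) by (auto simp: \<delta>_def hw_def)
  have q_le: "s * Im q \<le> s * Im p" using p(2) q(1) by blast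
  have S1: "z \<in> closed_segment p p' \<longleftrightarrow> Re z = Re p \<and> s * Im p \<le> s * Im z \<and> s * Im z \<le> s * Im p + \<delta>" for z
    using s pos by (auto simp: closed_segment_same_Re p'_def closed_segment_eq_real_ivl)
  have S2: "z \<in> closed_segment p' q' \<longleftrightarrow> s * Im z = s * Im p + \<delta> \<and> \<bar>Re z - Re m\<bar> \<le> hw" for z
    using s pos by (auto simp: closed_segment_same_Im p'_def q'_def m_def hw_def closed_segment_eq_real_ivl abs_if field_simps)
  have S3: "z \<in> closed_segment q' q \<longleftrightarrow> Re z = Re q \<and> s * Im q \<le> s * Im z \<and> s * Im z \<le> s * Im p + \<delta>" for z
    using s pos q_le by (auto simp: closed_segment_same_Re q'_def closed_segment_eq_real_ivl)
  have eqI: "z = w" if "Re z = Re w" "s * Im z = s * Im w" for z w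
    using that s by (auto simp: complex_eq_iff)
  have ht': "s * Im p' = s * Im p + \<delta>" "s * Im q' = s * Im p + \<delta>" "s * Im m = s * Im p + \<delta>"
    "Re p' = Re p" "Re q' = Re q"
    using s by (auto simp: p'_def q'_def m_def)
  have ne: "p \<noteq> p'" "p' \<noteq> q'" "q' \<noteq> q"
    using ht' q(2) q_le pos by auto
  define l where "l = linepath p p' +++ linepath p' q' +++ linepath q' q"
  have l_img: "path_image l = closed_segment p p' \<union> closed_segment p' q' \<union> closed_segment q' q"
    by (simp add: l_def path_image_join Un_assoc)
  have cap': "closed_segment p' q' \<inter> closed_segment q' q \<subseteq> {q'}"
    using S2 S3 ht' by (auto intro!: eqI)
  then have "arc (linepath p' q' +++ linepath q' q)"
    using ne by (intro arc_join) auto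
  moreover have "closed_segment p p' \<inter> (closed_segment p' q' \<union> closed_segment q' q) \<subseteq> {p'}"
    using S1 S2 S3 ht' q(2) by (auto intro!: eqI)
  ultimately have "arc l"
    unfolding l_def using ne cap' by (intro arc_join) (simp_all add: path_image_join)
  have l_ends: "pathstart l = p" "pathfinish l = q" by (auto simp: l_def)
  have cap: "path_image l \<inter> \<Gamma> \<subseteq> {p, q}"
  proof
    fix z assume z: "z \<in> path_image l \<inter> \<Gamma>"
    then have le: "s * Im z \<le> s * Im p" using p(2) by blast
    consider "z \<in> closed_segment p p'" | "z \<in> closed_segment p' q'" | "z \<in> closed_segment q' q"
      using z l_img by blast
    then show "z \<in> {p, q}"
    proof cases
      case 1
      then have "z = p" using S1 le by (intro eqI) (auto intro: antisym)
      then show ?thesis by simp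
    next
      case 2
      then show ?thesis using S2 le pos by auto
    next
      case 3
      then have "z = q" using S3 q(4)[of z] z by (intro eqI) (auto intro: antisym)
      then show ?thesis by simp
    qed
  qed
  define \<Gamma>1 where "\<Gamma>1 = path_image l \<union> path_image c"
  have "simple_path (l +++ c)"
    using \<open>arc l\<close> c l_ends cap by (intro simple_path_join_loop) auto
  then have J1: "Jordan_curve_set \<Gamma>1"
    unfolding Jordan_curve_set_def \<Gamma>1_def using c l_ends by (intro exI[of _ "l +++ c"]) (auto simp: path_image_join)
  have l_ball: "path_image l \<subseteq> ball p e"
  proof -
    have "dist p p' < e" using s pos by (auto simp: p'_def dist_norm cmod_def \<delta>_def)
    moreover have "dist p q' < e"
    proof -
      have "\<bar>Re p - Re q\<bar> < e / 4" using q(3) abs_Re_le_cmod[of "p - q"] by (simp add: dist_norm)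
      then show ?thesis
        using cmod_le[of "p - q'"] s pos by (auto simp: q'_def dist_norm \<delta>_def)
    qed
    moreover have "dist p q < e" using q(3) \<open>e > 0\<close> by simp
    ultimately show ?thesis
      unfolding l_img using \<open>e > 0\<close> by (intro Un_least closed_segment_subset) auto
  qed
  show ?thesis
  proof (rule that[of \<Gamma>1 "min \<delta> hw" m p, OF J1])
    show "s * Im z \<le> s * Im m" if "z \<in> \<Gamma>1" for z
    proof (cases "z \<in> path_image c")
      case True
      then show ?thesis using c(4) p(2)[of z] ht' pos by auto
    next
      case False
      then show ?thesis using that ht' by (auto simp: \<Gamma>1_def l_img S1 S2 S3)
    qed
    \<comment> \<open>The radius keeps the ball strictly beyond the level of \<open>p\<close>, where
      the old curve cannot be, and strictly between the two vertical sides.\<close>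
    show "z \<in> \<Gamma>1 \<longleftrightarrow> s * Im z = s * Im m" if z: "z \<in> ball m (min \<delta> hw)" for z
    proof -
      have "\<bar>Re z - Re m\<bar> < hw" "\<bar>Im z - Im m\<bar> < \<delta>"
        using z abs_Re_le_cmod[of "z - m"] abs_Im_le_cmod[of "z - m"] by (auto simp: dist_norm norm_minus_commute)
      moreover from this have "s * Im z > s * Im p" using ht'(3) s by auto
      then have "z \<notin> \<Gamma>" using p(2)[of z] by auto
      moreover have "\<bar>Re p - Re m\<bar> = hw" "\<bar>Re q - Re m\<bar> = hw" by (auto simp: m_def hw_def abs_if field_simps)
      ultimately show ?thesis
        using c(4) by (auto simp: \<Gamma>1_def l_img S1 S2 S3 ht')
    qed
    show "p \<in> \<Gamma>1" using l_ends by (metis UnI1 \<Gamma>1_def pathstart_in_path_image)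
    show "\<Gamma> - ball p e \<subseteq> \<Gamma>1" using c(5) \<open>e > 0\<close> by (fastforce simp: \<Gamma>1_def)
    show "\<Gamma>1 - ball p e \<subseteq> \<Gamma>" using c(4) l_ball by (auto simp: \<Gamma>1_def)
  qed (use p pos ht' in auto)
qed

text \<open>The curve is flattened at its top and then at its bottom, the second change being too
  small to disturb the first flat side. Each change costs at most \<open>\<epsilon> / 4\<close> in
  distance, in either direction.\<close>

lemma not_MP_solvable_near:
  assumes \<Gamma>: "Jordan_curve_set \<Gamma>" and "\<epsilon> > 0"
  shows "\<exists>\<Gamma>''. Jordan_curve_set \<Gamma>'' \<and> \<not> MP_solvable \<Gamma>'' \<and> Hausdorff_dist \<Gamma> \<Gamma>'' < \<epsilon>"
proof -
  have e1: "\<epsilon> / 4 > 0" using \<open>\<epsilon> > 0\<close> by simp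
  obtain \<Gamma>1 m r p where 1: "Jordan_curve_set \<Gamma>1" "r > 0" "\<And>z. z \<in> \<Gamma>1 \<Longrightarrow> Im z \<le> Im m"
    "\<And>z. z \<in> ball m r \<Longrightarrow> z \<in> \<Gamma>1 \<longleftrightarrow> Im z = Im m"
    "p \<in> \<Gamma>" "p \<in> \<Gamma>1" "\<And>z. z \<in> \<Gamma> \<Longrightarrow> Im z \<le> Im p" "Im p < Im m"
    "\<Gamma> - ball p (\<epsilon> / 4) \<subseteq> \<Gamma>1" "\<Gamma>1 - ball p (\<epsilon> / 4) \<subseteq> \<Gamma>"
    by (rule flatten_side[OF \<Gamma> disjI1[OF refl] e1, simplified mult_1_left]) (rule that; blast)
  \<comment> \<open>The lowest point \<open>q\<close> of \<open>\<Gamma>1\<close> is not above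
    \<open>p\<close>, so the second bound keeps \<open>ball q e\<close> more than \<open>e\<close>
    below the level of \<open>m\<close>.\<close>
  define e where "e = min (\<epsilon> / 4) ((Im m - Im p) / 2)"
  have e2: "e > 0" using e1 1(8) by (simp add: e_def)
  obtain \<Gamma>2 m' r' q where 2: "Jordan_curve_set \<Gamma>2" "r' > 0" "\<And>z. z \<in> \<Gamma>2 \<Longrightarrow> Im m' \<le> Im z"
    "\<And>z. z \<in> ball m' r' \<Longrightarrow> z \<in> \<Gamma>2 \<longleftrightarrow> Im z = Im m'"
    "q \<in> \<Gamma>1" "q \<in> \<Gamma>2" "\<And>z. z \<in> \<Gamma>1 \<Longrightarrow> Im q \<le> Im z" "Im m' < Im q"
    "\<Gamma>1 - ball q e \<subseteq> \<Gamma>2" "\<Gamma>2 - ball q e \<subseteq> \<Gamma>1"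
    by (rule flatten_side[OF 1(1) disjI2[OF refl] e2, simplified mult_minus1 neg_le_iff_le neg_less_iff_less neg_equal_iff_equal]) (rule that; blast)
  have low: "Im z < Im m - e" if "z \<in> ball q e" for z
  proof -
    have "Im q \<le> Im p" using 2(7) 1(6) by blast
    moreover have "Im z - Im q < e"
      using that abs_Im_le_cmod[of "z - q"] by (simp add: dist_norm norm_minus_commute)
    moreover have "e \<le> (Im m - Im p) / 2" unfolding e_def by (rule min.cobounded2)
    ultimately show ?thesis by argo
  qed
  have "\<not> MP_solvable \<Gamma>2"
  proof (rule two_flat_sides_not_MP_solvable[OF 2(1), of m "min r e" m' r'])
    show "Im z \<le> Im m" if "z \<in> \<Gamma>2" for z
      using that 2(10) 1(3) low[of z] e2 by (cases "z \<in> ball q e") auto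
    show "z \<in> \<Gamma>2 \<longleftrightarrow> Im z = Im m" if z: "z \<in> ball m (min r e)" for z
    proof -
      have "Im m - Im z < e"
        using z abs_Im_le_cmod[of "m - z"] by (auto simp: dist_norm)
      then have "z \<notin> ball q e" using low[of z] by auto
      then have "z \<in> \<Gamma>2 \<longleftrightarrow> z \<in> \<Gamma>1" using 2(9,10) by blast
      then show ?thesis using 1(4)[of z] z by simp
    qed
  qed (use 2 1(2) e2 in auto)
  moreover have "Hausdorff_dist \<Gamma> \<Gamma>2 \<le> \<epsilon> / 2"
  proof (rule Hausdorff_dist_le)
    \<comment> \<open>Either \<open>x\<close> survives the change, or it lies in the changed ball,
      whose centre belongs to \<open>B\<close>.\<close>
    have near: "\<exists>y\<in>B. dist x y \<le> \<epsilon> / 4" if "x \<in> A" "A - ball c \<eta> \<subseteq> B" "c \<in> B" "\<eta> \<le> \<epsilon> / 4" for x c :: complex and A B \<eta>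
    proof (cases "x \<in> ball c \<eta>")
      case True
      then show ?thesis using that by (intro bexI[of _ c]) (auto simp: dist_commute)
    next
      case False
      then show ?thesis using that \<open>\<epsilon> > 0\<close> by (intro bexI[of _ x]) auto
    qed
    have "e \<le> \<epsilon> / 4" by (simp add: e_def)
    show "\<exists>y\<in>\<Gamma>2. dist x y \<le> \<epsilon> / 2" if x\<Gamma>: "x \<in> \<Gamma>" for x
    proof -
      obtain y where y: "y \<in> \<Gamma>1" "dist x y \<le> \<epsilon> / 4" using near[OF x\<Gamma> 1(9,6)] by auto
      obtain z where z: "z \<in> \<Gamma>2" "dist y z \<le> \<epsilon> / 4" using near[OF y(1) 2(9,6)] \<open>e \<le> _\<close> by auto
      show ?thesis using y z dist_triangle[of x z y] by (intro bexI[of _ z]) auto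
    qed
    show "\<exists>x\<in>\<Gamma>. dist z x \<le> \<epsilon> / 2" if z\<Gamma>: "z \<in> \<Gamma>2" for z
    proof -
      obtain y where y: "y \<in> \<Gamma>1" "dist z y \<le> \<epsilon> / 4" using near[OF z\<Gamma> 2(10,5)] \<open>e \<le> _\<close> by auto
      obtain x where x: "x \<in> \<Gamma>" "dist y x \<le> \<epsilon> / 4" using near[OF y(1) 1(10,5)] by auto
      show ?thesis using y x dist_triangle[of z x y] by (intro bexI[of _ x]) auto
    qed
  qed (use 1 2 in auto)
  ultimately show ?thesis using 2(1) \<open>\<epsilon> > 0\<close> by (intro exI[of _ \<Gamma>2]) auto
qed

section \<open>Averages over roots of unity\<close>

definition root_average :: "nat \<Rightarrow> (complex \<Rightarrow> complex) \<Rightarrow> complex \<Rightarrow> complex" where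
  "root_average n h u = (\<Sum>j<n. h (u * cis (2 * pi * real j / real n))) / of_nat n"

text \<open>Rotation through one step shifts the sum cyclically: the term at index \<open>n\<close>
  equals the one at index \<open>0\<close>.\<close>

lemma root_average_rotate:
  assumes "n > 0"
  shows "root_average n h (u * cis (2 * pi * real k / real n)) = root_average n h u"
proof -
  have step: "root_average n h (u * cis (2 * pi / real n)) = root_average n h u" for u
  proof -
    obtain m where m: "n = Suc m" using assms gr0_implies_Suc by blast
    have "(\<Sum>j<n. h (u * cis (2 * pi / real n) * cis (2 * pi * real j / real n))) =
          (\<Sum>j<n. h (u * cis (2 * pi * real (Suc j) / real n)))"
      by (intro sum.cong refl) (simp add: cis_mult add_divide_distrib algebra_simps)
    also have "\<dots> = (\<Sum>j<n. h (u * cis (2 * pi * real j / real n)))"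
    proof -
      have "cis (2 * pi * real (Suc m) / real n) = 1" by (simp add: m)
      then have eq: "h (u * cis (2 * pi * real (Suc m) / real n)) = h (u * cis (2 * pi * real 0 / real n))"
        by simp
      show ?thesis
        unfolding m using eq[unfolded m]
        by (subst (2) sum.lessThan_Suc_shift) simp
    qed
    finally show ?thesis by (simp add: root_average_def)
  qed
  show ?thesis
  proof (induction k)
    case (Suc k)
    have "u * cis (2 * pi * real (Suc k) / real n) = u * cis (2 * pi * real k / real n) * cis (2 * pi / real n)"
      by (simp add: cis_mult add_divide_distrib algebra_simps)
    then show ?case using step Suc by metis
  qed simp
qed

lemma norm_cis_minus_1_le: "cmod (cis x - 1) \<le> \<bar>x\<bar>"
  using dist_exp_i_1[of x] abs_sin_x_le_abs_x[of "x / 2"] by (simp add: cis_conv_exp)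

text \<open>The average is invariant under rotation by \<open>2 * pi / n\<close>, so on the circle of radius \<open>r\<close> it is almost
  constant as a function of its base point. The maximum principle carries this to the centre.\<close>

lemma root_average_close:
  assumes "n > 0" "r > 0"
    and hol: "h holomorphic_on ball 0 r" and cont: "continuous_on (cball 0 r) h"
    and osc: "\<And>u v. u \<in> sphere 0 r \<Longrightarrow> v \<in> sphere 0 r \<Longrightarrow> dist u v < \<delta> \<Longrightarrow> dist (h u) (h v) \<le> e"
    and n: "2 * pi * r / real n < \<delta>"
  shows "cmod (root_average n h (of_real r) - h 0) \<le> e"
proof -
  let ?w = "\<lambda>j. cis (2 * pi * real j / real n)"
  define H where "H = (\<lambda>u. root_average n h u - root_average n h (of_real r))"
  have bd: "cmod (H u) \<le> e" if "u \<in> sphere 0 r" for u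
  proof -
    define t where "t = Arg2pi u"
    have t: "0 \<le> t" "u = of_real r * cis t"
      using Arg2pi[of u] that by (auto simp: t_def cis_conv_exp is_Arg_def)
    \<comment> \<open>\<open>k\<close> counts the full steps \<open>2 * pi / n\<close> in the
      argument of \<open>u\<close>. The remainder \<open>s\<close> is at most one step, so rotating
      back brings \<open>u\<close> close to the base point \<open>r\<close>.\<close>
    define k where "k = nat \<lfloor>t * n / (2 * pi)\<rfloor>"
    define s where "s = t - 2 * pi * real k / real n"
    have rk: "real k = of_int \<lfloor>t * n / (2 * pi)\<rfloor>"
      using t(1) by (simp add: k_def)
    then have "real k \<le> t * n / (2 * pi)" "t * n / (2 * pi) < real k + 1"
      by linarith+
    then have "2 * pi * real k \<le> t * n" "t * n \<le> 2 * pi * real k + 2 * pi"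
      by (simp_all add: field_simps)
    moreover have "s = (t * n - 2 * pi * real k) / n"
      using \<open>n > 0\<close> by (simp add: s_def field_simps)
    ultimately have s: "0 \<le> s" "s \<le> 2 * pi / real n"
      by (auto simp: divide_right_mono)
    have "u = of_real r * cis s * ?w k"
      using t(2) by (simp add: s_def cis_mult mult.assoc)
    then have "H u = root_average n h (of_real r * cis s) - root_average n h (of_real r)"
      unfolding H_def using root_average_rotate[OF \<open>n > 0\<close>] by metis
    also have "\<dots> = (\<Sum>j<n. h (of_real r * cis s * ?w j) - h (of_real r * ?w j)) / of_nat n"
      by (simp add: root_average_def sum_subtractf diff_divide_distrib)
    finally have Hu: "H u = (\<Sum>j<n. h (of_real r * cis s * ?w j) - h (of_real r * ?w j)) / of_nat n" .
    have "cmod (\<Sum>j<n. h (of_real r * cis s * ?w j) - h (of_real r * ?w j)) \<le> (\<Sum>j<n. e)"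
    proof (rule sum_norm_le)
      fix j
      have "dist (of_real r * cis s * ?w j) (of_real r * ?w j) = r * cmod (cis s - 1)"
      proof -
        have "of_real r * cis s * ?w j - of_real r * ?w j = of_real r * (cis s - 1) * ?w j"
          by (simp add: algebra_simps)
        then show ?thesis using \<open>r > 0\<close> by (simp add: dist_norm norm_mult)
      qed
      also have "\<dots> \<le> r * (2 * pi / real n)"
        using s norm_cis_minus_1_le[of s] \<open>r > 0\<close> by (intro mult_left_mono) auto
      also have "\<dots> < \<delta>" using n by (simp add: mult.commute)
      finally show "cmod (h (of_real r * cis s * ?w j) - h (of_real r * ?w j)) \<le> e"
        using osc[of "of_real r * cis s * ?w j" "of_real r * ?w j"] \<open>r > 0\<close>
        by (simp add: dist_norm norm_mult)
    qed
    then show ?thesis using \<open>n > 0\<close> unfolding Hu by (simp add: norm_divide field_simps)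
  qed
  have "cmod (H 0) \<le> e"
  proof (rule maximum_modulus_frontier[of H "ball 0 r"])
    have sub: "(\<lambda>u. u * ?w j) ` ball 0 r \<subseteq> ball 0 r" "(\<lambda>u. u * ?w j) ` cball 0 r \<subseteq> cball 0 r" for j
      by (auto simp: norm_mult)
    have "(\<lambda>u. h (u * ?w j)) holomorphic_on ball 0 r" for j
      using holomorphic_on_compose_gen[OF _ hol sub(1)[of j]]
      by (auto simp: o_def holomorphic_on_mult)
    then show "H holomorphic_on interior (ball 0 r)"
      unfolding H_def root_average_def using \<open>n > 0\<close> by (auto intro!: holomorphic_intros)
    have "continuous_on (cball 0 r) (\<lambda>u. h (u * ?w j))" for j
      by (rule continuous_on_compose2[OF cont]) (use sub(2) in \<open>auto intro!: continuous_intros\<close>)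
    then show "continuous_on (closure (ball 0 r)) H"
      unfolding H_def root_average_def using \<open>n > 0\<close> \<open>r > 0\<close> by (auto intro!: continuous_intros)
  qed (use bd \<open>r > 0\<close> in auto)
  moreover have "root_average n h 0 = h 0"
    using \<open>n > 0\<close> by (simp add: root_average_def)
  ultimately show ?thesis by (simp add: H_def norm_minus_commute)
qed

text \<open>Uniform continuity on the compact product gives one modulus of continuity for all
  parameters \<open>w\<close>, so the threshold for \<open>n\<close> does not depend on
  \<open>w\<close>.\<close>

lemma root_average_uniform:
  fixes W :: "'a::metric_space set"
  assumes "r > 0" "compact W" "e > 0"
    and joint: "continuous_on (sphere 0 r \<times> W) (\<lambda>(v, w). h w v)"
    and hol: "\<And>w. w \<in> W \<Longrightarrow> h w holomorphic_on ball 0 r"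
    and cont: "\<And>w. w \<in> W \<Longrightarrow> continuous_on (cball 0 r) (h w)"
  shows "\<forall>\<^sub>F n in sequentially. \<forall>w\<in>W. cmod (root_average n (h w) (of_real r) - h w 0) \<le> e"
proof -
  have "uniformly_continuous_on (sphere 0 r \<times> W) (\<lambda>(v, w). h w v)"
    using assms by (intro compact_uniformly_continuous compact_Times) auto
  then obtain \<delta> where "\<delta> > 0" and \<delta>: "\<And>x y. x \<in> sphere 0 r \<times> W \<Longrightarrow> y \<in> sphere 0 r \<times> W \<Longrightarrow> dist y x < \<delta>
      \<Longrightarrow> dist ((\<lambda>(v, w). h w v) y) ((\<lambda>(v, w). h w v) x) < e"
    unfolding uniformly_continuous_on_def using \<open>e > 0\<close> by meson
  have "\<forall>\<^sub>F n in sequentially. 2 * pi * r / real n < \<delta>"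
    using \<open>\<delta> > 0\<close> by real_asymp
  moreover have "\<forall>\<^sub>F n in sequentially. n > (0::nat)"
    by (rule eventually_gt_at_top)
  ultimately show ?thesis
  proof eventually_elim
    case (elim n)
    show ?case
    proof
      fix w assume w: "w \<in> W"
      show "cmod (root_average n (h w) (of_real r) - h w 0) \<le> e"
      proof (rule root_average_close[OF elim(2) \<open>r > 0\<close> hol[OF w] cont[OF w] _ elim(1)])
        fix u v :: complex assume "u \<in> sphere 0 r" "v \<in> sphere 0 r" "dist u v < \<delta>"
        then show "dist (h w u) (h w v) \<le> e"
          using \<delta>[of "(v, w)" "(u, w)"] w by (auto simp: dist_Pair_Pair)
      qed
    qed
  qed
qed

section \<open>Difference quotients and logarithms of holomorphic functions\<close>

lemma holomorphic_difference_quotient: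
  assumes "f holomorphic_on S" "open S" "a \<in> S"
  shows "(\<lambda>z. if z = a then deriv f a else (f z - f a) / (z - a)) holomorphic_on S"
  by (rule pole_theorem_open_0[of "\<lambda>z. f z - f a" S a])
     (use assms in \<open>auto intro!: holomorphic_intros simp: holomorphic_on_imp_differentiable_at\<close>)

text \<open>The logarithmic derivative is recorded because the later estimates compare logarithms
  through their derivatives.\<close>

lemma holomorphic_log_convex:
  fixes S :: "complex set"
  assumes "f holomorphic_on S" "open S" "convex S" "\<And>w. w \<in> S \<Longrightarrow> f w \<noteq> 0"
  obtains g where "g holomorphic_on S" "\<And>w. w \<in> S \<Longrightarrow> f w = exp (g w)"
     "\<And>w. w \<in> S \<Longrightarrow> deriv g w = deriv f w / f w"
proof -
  obtain g where g: "g holomorphic_on S" "\<And>w. w \<in> S \<Longrightarrow> f w = exp (g w)"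
    using contractible_imp_holomorphic_log[OF assms(1) convex_imp_contractible[OF assms(3)] assms(4)] by metis
  moreover have "deriv g w = deriv f w / f w" if w: "w \<in> S" for w
  proof -
    have "(g has_field_derivative deriv g w) (at w)"
      by (rule holomorphic_derivI[OF g(1) assms(2) w])
    then have "((\<lambda>w. exp (g w)) has_field_derivative exp (g w) * deriv g w) (at w)"
      by (auto intro!: derivative_eq_intros)
    then have "(f has_field_derivative exp (g w) * deriv g w) (at w)"
      by (rule has_field_derivative_transform_within_open[OF _ assms(2) w]) (simp add: g(2))
    then show ?thesis using g(2)[OF w] by (simp add: DERIV_imp_deriv)
  qed
  ultimately show ?thesis using that by blast
qed

section \<open>Rational functions built from a univalent map of the disc\<close>

context
  fixes \<psi> :: "complex \<Rightarrow> complex" and r :: real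
  assumes hol: "\<psi> holomorphic_on ball 0 1" and inj: "inj_on \<psi> (ball 0 1)" and r: "0 < r" "r < 1"
begin

lemma univalent_eq_iff: "z \<in> ball 0 1 \<Longrightarrow> w \<in> ball 0 1 \<Longrightarrow> \<psi> z = \<psi> w \<longleftrightarrow> z = w"
  using inj by (auto simp: inj_on_def)

lemma univalent_deriv_nonzero: "w \<in> ball 0 1 \<Longrightarrow> deriv \<psi> w \<noteq> 0"
  using holomorphic_injective_imp_regular[OF hol _ inj] by simp

text \<open>The poles of the two terms at \<open>v = w\<close> cancel.\<close>

lemma univalent_kernel_holomorphic:
  assumes w: "w \<in> ball 0 1"
  shows "\<exists>h. h holomorphic_on ball 0 1 \<and>
     (\<forall>v \<in> ball 0 1. v \<noteq> w \<longrightarrow> h v = 1 / (v - w) - deriv \<psi> w / (\<psi> v - \<psi> w))"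
proof -
  define D where "D = (\<lambda>v. if v = w then deriv \<psi> w else (\<psi> v - \<psi> w) / (v - w))"
  have D: "D holomorphic_on ball 0 1"
    unfolding D_def by (rule holomorphic_difference_quotient[OF hol _ w]) simp
  have Dnz: "D v \<noteq> 0" if "v \<in> ball 0 1" for v
    using that w univalent_deriv_nonzero by (auto simp: D_def univalent_eq_iff)
  \<comment> \<open>\<open>F\<close> vanishes at \<open>w\<close>, because
    \<open>D w = deriv \<psi> w\<close>, so dividing it by \<open>v - w\<close> leaves no pole and
    yields the kernel.\<close>
  define F where "F = (\<lambda>v. 1 - deriv \<psi> w / D v)"
  have F: "F holomorphic_on ball 0 1"
    unfolding F_def using D Dnz by (intro holomorphic_intros) auto
  have F0: "F w = 0"
    using univalent_deriv_nonzero[OF w] by (simp add: F_def D_def)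
  define h where "h = (\<lambda>v. if v = w then deriv F w else (F v - F w) / (v - w))"
  have "h holomorphic_on ball 0 1"
    unfolding h_def by (rule holomorphic_difference_quotient[OF F _ w]) simp
  moreover have "h v = 1 / (v - w) - deriv \<psi> w / (\<psi> v - \<psi> w)" if "v \<in> ball 0 1" "v \<noteq> w" for v
    using that univalent_eq_iff[OF that(1) w]
    by (simp add: h_def F0) (simp add: F_def D_def field_simps)
  ultimately show ?thesis by blast
qed

text \<open>The kernel \<open>1 / (v - w) - deriv \<psi> w / (\<psi> v - \<psi> w)\<close> extends
  holomorphically in \<open>v\<close>, so its average over equally spaced points of the circle of
  radius \<open>r\<close> approaches its value at \<open>0\<close>. The average of
  \<open>1 / (v - w)\<close> alone approaches \<open>0\<close>, because \<open>w\<close> lies inside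
  that circle. Comparing the two gives the estimate.\<close>

lemma univalent_kernel_root_average:
  assumes \<rho>: "0 < \<rho>" "\<rho> < r" and e: "e > 0"
  shows "\<exists>n>0. \<forall>w\<in>sphere 0 \<rho>. 
     cmod (deriv \<psi> w / (\<psi> w - \<psi> 0) - 1 / w - root_average n (\<lambda>v. deriv \<psi> w / (\<psi> w - \<psi> v)) (of_real r)) \<le> e"
proof -
  have sub: "sphere 0 r \<subseteq> ball (0::complex) 1" "sphere 0 \<rho> \<subseteq> ball (0::complex) 1" "cball 0 r \<subseteq> ball (0::complex) 1"
    "ball 0 r \<subseteq> ball (0::complex) 1"
    using r \<rho> by auto
  obtain h where h: "\<And>w. w \<in> ball 0 1 \<Longrightarrow> h w holomorphic_on ball 0 1"
    "\<And>w v. w \<in> ball 0 1 \<Longrightarrow> v \<in> ball 0 1 \<Longrightarrow> v \<noteq> w \<Longrightarrow> h w v = 1 / (v - w) - deriv \<psi> w / (\<psi> v - \<psi> w)"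
    using univalent_kernel_holomorphic by metis
  have cpsi: "continuous_on (ball 0 1) \<psi>" "continuous_on (ball 0 1) (deriv \<psi>)"
    using hol by (auto intro!: holomorphic_on_imp_continuous_on holomorphic_deriv)
  have ne: "v \<noteq> w" "\<psi> v \<noteq> \<psi> w" if "v \<in> sphere 0 r" "w \<in> sphere 0 \<rho>" for v w
    using that \<rho> sub univalent_eq_iff[of v w] by auto
  have "\<forall>\<^sub>F n in sequentially. \<forall>w\<in>sphere 0 \<rho>. cmod (root_average n (h w) (of_real r) - h w 0) \<le> e / 2"
  proof (rule root_average_uniform)
    have "continuous_on (sphere 0 r \<times> sphere 0 \<rho>) (\<lambda>(v, w). 1 / (v - w) - deriv \<psi> w / (\<psi> v - \<psi> w))"
      unfolding case_prod_unfold
      by (intro continuous_intros continuous_on_compose2[OF cpsi(1)] continuous_on_compose2[OF cpsi(2)])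
         (use ne sub in \<open>force+\<close>)
    then show "continuous_on (sphere 0 r \<times> sphere 0 \<rho>) (\<lambda>(v, w). h w v)"
      by (rule continuous_on_eq) (use h(2) ne sub in \<open>auto simp: subset_iff\<close>)
    show "h w holomorphic_on ball 0 r" "continuous_on (cball 0 r) (h w)" if "w \<in> sphere 0 \<rho>" for w
      using h(1) that sub by (meson holomorphic_on_subset holomorphic_on_imp_continuous_on subsetD)+
  qed (use r e in auto)
  txt \<open>On \<open>sphere 0 r\<close> the function \<open>1 / (v - w)\<close> is the conjugate of \<open>v / (r\<^sup>2 - cnj w * v)\<close>, which is
    holomorphic in the disc and vanishes at \<open>0\<close>.\<close>
  moreover have "\<forall>\<^sub>F n in sequentially. \<forall>w\<in>sphere 0 \<rho>.
     cmod (root_average n (\<lambda>v. v / (of_real (r\<^sup>2) - cnj w * v)) (of_real r) - 0 / (of_real (r\<^sup>2) - cnj w * 0)) \<le> e / 2"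
  proof (rule root_average_uniform)
    have nz: "of_real (r\<^sup>2) - cnj w * v \<noteq> 0" if "w \<in> sphere 0 \<rho>" "v \<in> cball 0 r" for v w
    proof
      assume "of_real (r\<^sup>2) - cnj w * v = 0"
      then have "cmod (of_real (r\<^sup>2)) = cmod (cnj w * v)" by simp
      then have "r\<^sup>2 = \<rho> * cmod v" using that by (simp add: norm_mult norm_power)
      also have "\<dots> \<le> \<rho> * r" using that \<rho> by (intro mult_left_mono) auto
      also have "\<dots> < r\<^sup>2" using \<rho> r by (simp add: power2_eq_square)
      finally show False by simp
    qed
    show "continuous_on (sphere 0 r \<times> sphere 0 \<rho>) (\<lambda>(v, w). v / (of_real (r\<^sup>2) - cnj w * v))"
      unfolding case_prod_unfold by (intro continuous_intros) (use nz in auto)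
    show "(\<lambda>v. v / (of_real (r\<^sup>2) - cnj w * v)) holomorphic_on ball 0 r"
         "continuous_on (cball 0 r) (\<lambda>v. v / (of_real (r\<^sup>2) - cnj w * v))" if "w \<in> sphere 0 \<rho>" for w
      using nz that by (auto intro!: holomorphic_intros continuous_intros)
  qed (use r e in auto)
  moreover have "\<forall>\<^sub>F n in sequentially. n > (0::nat)"
    by (rule eventually_gt_at_top)
  ultimately have "\<forall>\<^sub>F n in sequentially. n > 0 \<and> (\<forall>w\<in>sphere 0 \<rho>. 
     cmod (deriv \<psi> w / (\<psi> w - \<psi> 0) - 1 / w - root_average n (\<lambda>v. deriv \<psi> w / (\<psi> w - \<psi> v)) (of_real r)) \<le> e)"
  proof (eventually_elim, intro conjI ballI)
    case (elim n)
    fix w :: complex assume w: "w \<in> sphere 0 \<rho>"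
    let ?v = "\<lambda>j. of_real r * cis (2 * pi * real j / real n)"
    have v: "?v j \<in> sphere 0 r" for j using r by (simp add: norm_mult)
    have w0: "w \<noteq> 0" "w \<in> ball 0 1" using w \<rho> r by auto
    have h0: "h w 0 = deriv \<psi> w / (\<psi> w - \<psi> 0) - 1 / w"
      using h(2)[OF w0(2), of 0] w0 univalent_eq_iff[of 0 w] by (simp add: field_simps)
    have cnj_eq: "cnj (v / (of_real (r\<^sup>2) - cnj w * v)) = 1 / (v - w)" if v: "v \<in> sphere 0 r" for v
    proof -
      have r2: "of_real (r\<^sup>2) = v * cnj v" using v by (simp add: complex_norm_square[symmetric])
      have "v \<noteq> 0" "cnj v \<noteq> 0" using v r by auto
      moreover have "cnj (v / (of_real (r\<^sup>2) - cnj w * v)) = cnj v / (cnj v * (v - w))"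
        unfolding r2 by (simp add: algebra_simps)
      ultimately show ?thesis by simp
    qed
    define Q where "Q = (\<lambda>v. v / (of_real (r\<^sup>2) - cnj w * v))"
    have "root_average n (h w) (of_real r) = cnj (root_average n Q (of_real r))
         + root_average n (\<lambda>v. deriv \<psi> w / (\<psi> w - \<psi> v)) (of_real r)"
    proof -
      have "h w (?v j) = cnj (Q (?v j)) + deriv \<psi> w / (\<psi> w - \<psi> (?v j))" for j
      proof -
        have "h w (?v j) = 1 / (?v j - w) - deriv \<psi> w / (\<psi> (?v j) - \<psi> w)"
          using v[of j] ne(1)[OF v w] sub(1) by (intro h(2) w0(2)) blast+
        moreover have "deriv \<psi> w / (\<psi> w - \<psi> (?v j)) = - (deriv \<psi> w / (\<psi> (?v j) - \<psi> w))"
          by (metis minus_diff_eq minus_divide_right)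
        ultimately show ?thesis unfolding Q_def cnj_eq[OF v] by simp
      qed
      then show ?thesis
        by (simp add: root_average_def sum.distrib add_divide_distrib)
    qed
    \<comment> \<open>The total error is that of the kernel average plus that of the conjugated
      average, each at most \<open>e / 2\<close>. The quotient with numerator \<open>0\<close> is
      the value of \<open>Q\<close> at \<open>0\<close>.\<close>
    then have "deriv \<psi> w / (\<psi> w - \<psi> 0) - 1 / w - root_average n (\<lambda>v. deriv \<psi> w / (\<psi> w - \<psi> v)) (of_real r)
        = - (root_average n (h w) (of_real r) - h w 0)
          + cnj (root_average n (\<lambda>v. v / (of_real (r\<^sup>2) - cnj w * v)) (of_real r) - 0 / (of_real (r\<^sup>2) - cnj w * 0))"
      unfolding h0 Q_def by simp
    also have "cmod \<dots> \<le> e / 2 + e / 2"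
      using elim w by (intro norm_triangle_mono) (auto simp only: norm_minus_cancel complex_mod_cnj)
    finally show "cmod (deriv \<psi> w / (\<psi> w - \<psi> 0) - 1 / w - root_average n (\<lambda>v. deriv \<psi> w / (\<psi> w - \<psi> v)) (of_real r)) \<le> e"
      by simp
  qed auto
  then show ?thesis by (auto simp: eventually_sequentially)
qed

text \<open>\<open>E w\<close> is \<open>w * exp (l w - l 0)\<close>, where \<open>n * l\<close> is
  a logarithm of \<open>((\<psi> w - \<psi> 0) / w) ^ n\<close> divided by the product of the
  factors \<open>\<psi> w - p j\<close>. The root average estimate bounds exactly the derivative of
  \<open>l\<close>. Subtracting \<open>l 0\<close> normalises \<open>E w / w\<close> to be
  \<open>1\<close> at the origin and produces the constant \<open>c\<close>.\<close>

lemma rational_root_near_identity: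
  assumes \<rho>: "0 < \<rho>" "\<rho> < r" and e: "e > 0"
  obtains n E p c where "n > 0" "E holomorphic_on ball 0 r" "E 0 = 0" "c \<noteq> 0"
    "\<And>w. w \<in> cball 0 \<rho> \<Longrightarrow> cmod (E w - w) \<le> e"
    "\<And>j. p j \<in> \<psi> ` sphere 0 r"
    "\<And>w. w \<in> ball 0 r \<Longrightarrow> c * (\<psi> w - \<psi> 0) ^ n = E w ^ n * (\<Prod>j<n. \<psi> w - p j)"
proof -
  have sub: "ball 0 r \<subseteq> ball (0::complex) 1" using r by auto
  have "isCont exp (0::complex)" by simp
  \<comment> \<open>\<open>d\<close> is the tolerance for \<open>l w - l 0\<close> that keeps its
    exponential within \<open>e\<close> of \<open>1\<close>.\<close>
  then obtain d where d: "d > 0" "\<And>x::complex. cmod x < d \<Longrightarrow> cmod (exp x - 1) < e"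
    using e unfolding continuous_at_eps_delta by (auto simp: dist_norm)
  obtain n where n: "n > 0" "\<And>w. w\<in>sphere 0 \<rho> \<Longrightarrow>
     cmod (deriv \<psi> w / (\<psi> w - \<psi> 0) - 1 / w - root_average n (\<lambda>v. deriv \<psi> w / (\<psi> w - \<psi> v)) (of_real r)) \<le> d / 2"
    using univalent_kernel_root_average[OF \<rho>, of "d / 2"] d(1) by auto
  define v where "v = (\<lambda>j. of_real r * cis (2 * pi * real j / real n))"
  have v: "v j \<in> sphere 0 r" for j using r by (simp add: v_def norm_mult)
  have "\<exists>g. g holomorphic_on ball 0 r \<and> (\<forall>w\<in>ball 0 r. \<psi> w - \<psi> (v j) = exp (g w)
       \<and> deriv g w = deriv \<psi> w / (\<psi> w - \<psi> (v j)))" for j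
  proof -
    have 1: "(\<lambda>w. \<psi> w - \<psi> (v j)) holomorphic_on ball 0 r"
      using hol sub by (auto intro!: holomorphic_intros intro: holomorphic_on_subset)
    have 2: "\<psi> w - \<psi> (v j) \<noteq> 0" if "w \<in> ball 0 r" for w
      using that v[of j] univalent_eq_iff[of w "v j"] r by auto
    have 3: "deriv (\<lambda>w. \<psi> w - \<psi> (v j)) w = deriv \<psi> w" if "w \<in> ball 0 r" for w
      using that hol sub by (subst deriv_diff) (auto simp: holomorphic_on_imp_differentiable_at)
    from holomorphic_log_convex[OF 1 open_ball convex_ball 2] 3 show ?thesis by metis
  qed
  then obtain g where g: "\<And>j. g j holomorphic_on ball 0 r"
     "\<And>j w. w \<in> ball 0 r \<Longrightarrow> exp (g j w) = \<psi> w - \<psi> (v j)"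
     "\<And>j w. w \<in> ball 0 r \<Longrightarrow> deriv (g j) w = deriv \<psi> w / (\<psi> w - \<psi> (v j))"
    by metis
  \<comment> \<open>Dividing by \<open>w\<close> removes the zero of
    \<open>\<psi> w - \<psi> 0\<close>, and by univalence there is no other, so \<open>T\<close> has
    a logarithm in the disc.\<close>
  define T where "T = (\<lambda>w. if w = 0 then deriv \<psi> 0 else (\<psi> w - \<psi> 0) / (w - 0))"
  have T1: "T holomorphic_on ball 0 r"
    unfolding T_def using sub by (intro holomorphic_on_subset[OF holomorphic_difference_quotient[OF hol]]) auto
  have T2: "T w \<noteq> 0" if "w \<in> ball 0 r" for w
    using that univalent_deriv_nonzero[of 0] univalent_eq_iff[of w 0] sub r by (auto simp: T_def)
  obtain t where t: "t holomorphic_on ball 0 r" "\<And>w. w \<in> ball 0 r \<Longrightarrow> T w = exp (t w)"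
     "\<And>w. w \<in> ball 0 r \<Longrightarrow> deriv t w = deriv T w / T w"
    using holomorphic_log_convex[OF T1 open_ball convex_ball T2] by metis
  have dT: "deriv t w = deriv \<psi> w / (\<psi> w - \<psi> 0) - 1 / w" if w: "w \<in> ball 0 r" "w \<noteq> 0" for w
  proof -
    have "(\<psi> has_field_derivative deriv \<psi> w) (at w)"
      using hol sub w by (intro holomorphic_derivI[of _ "ball 0 1"]) auto
    then have "((\<lambda>w. (\<psi> w - \<psi> 0) / w) has_field_derivative (deriv \<psi> w * w - (\<psi> w - \<psi> 0)) / (w * w)) (at w)"
      using w by (auto intro!: derivative_eq_intros)
    then have "(T has_field_derivative (deriv \<psi> w * w - (\<psi> w - \<psi> 0)) / (w * w)) (at w)"
      by (rule has_field_derivative_transform_within_open[of _ _ _ "- {0}"]) (use w in \<open>auto simp: T_def\<close>)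
    then have dTw: "deriv T w = (deriv \<psi> w * w - (\<psi> w - \<psi> 0)) / (w * w)"
      by (rule DERIV_imp_deriv)
    have "\<psi> w \<noteq> \<psi> 0" using w univalent_eq_iff[of w 0] sub by auto
    moreover have Tw: "T w = (\<psi> w - \<psi> 0) / w" using w(2) by (simp add: T_def)
    ultimately show ?thesis
      using w(2) unfolding t(3)[OF w(1)] dTw Tw by (simp add: field_simps)
  qed
  txt \<open>Up to an additive constant, \<open>l\<close> is the logarithm of \<open>E w / w\<close>.\<close>
  define l where "l = (\<lambda>w. t w - (\<Sum>j<n. g j w) / of_nat n)"
  have l: "l holomorphic_on ball 0 r"
    unfolding l_def using t(1) g(1) n(1) by (auto intro!: holomorphic_intros)
  have dl: "deriv l w = deriv t w - root_average n (\<lambda>v. deriv \<psi> w / (\<psi> w - \<psi> v)) (of_real r)" if w: "w \<in> ball 0 r" for w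
  proof -
    have "(g j has_field_derivative deriv \<psi> w / (\<psi> w - \<psi> (v j))) (at w)" for j
      using w by (subst g(3)[OF w, symmetric]) (rule holomorphic_derivI[OF g(1) open_ball])
    moreover have "(t has_field_derivative deriv t w) (at w)"
      using t(1) w by (simp add: holomorphic_derivI)
    ultimately have "(l has_field_derivative deriv t w - (\<Sum>j<n. deriv \<psi> w / (\<psi> w - \<psi> (v j))) / of_nat n) (at w)"
      unfolding l_def by (intro DERIV_diff DERIV_cdivide DERIV_sum)
    then show ?thesis by (simp add: DERIV_imp_deriv root_average_def v_def)
  qed
  \<comment> \<open>The root average estimate is available on the circle of radius
    \<open>\<rho>\<close>; the maximum principle extends it to the disc.\<close>
  have dl_le: "cmod (deriv l w) \<le> d / 2" if "w \<in> cball 0 \<rho>" for w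
  proof (rule maximum_modulus_frontier[of "deriv l" "cball 0 \<rho>"])
    have "deriv l holomorphic_on ball 0 r" by (rule holomorphic_deriv[OF l]) simp
    then show "deriv l holomorphic_on interior (cball 0 \<rho>)" "continuous_on (closure (cball 0 \<rho>)) (deriv l)"
      using \<rho> by (auto elim!: holomorphic_on_subset intro!: holomorphic_on_imp_continuous_on)
    fix z :: complex assume "z \<in> frontier (cball 0 \<rho>)"
    then have z: "z \<in> sphere 0 \<rho>" using \<rho> by auto
    then have "z \<in> ball 0 r" "z \<noteq> 0" using \<rho> by auto
    then show "cmod (deriv l z) \<le> d / 2" using n(2)[OF z] by (simp add: dl dT)
  qed (use that in auto)
  have l_le: "cmod (l w - l 0) < d" if w: "w \<in> cball 0 \<rho>" for w
  proof -
    have "cmod (l w - l 0) \<le> d / 2 * cmod (w - 0)"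
    proof (rule field_differentiable_bound[OF convex_cball[of 0 \<rho>]])
      show "(l has_field_derivative deriv l z) (at z within cball 0 \<rho>)" if "z \<in> cball 0 \<rho>" for z
        using that l \<rho> by (intro holomorphic_derivI[of _ "ball 0 r"]) auto
    qed (use dl_le w \<rho> in auto)
    also have "\<dots> \<le> d / 2 * 1" using w \<rho> r d by (intro mult_left_mono) auto
    finally show ?thesis using d(1) by simp
  qed
  define E where "E = (\<lambda>w. w * exp (l w - l 0))"
  define c where "c = exp (- of_nat n * l 0)"
  show ?thesis
  proof (rule that[of n E c "\<lambda>j. \<psi> (v j)"])
    show "E holomorphic_on ball 0 r"
      unfolding E_def using l by (auto intro!: holomorphic_intros)
    fix w :: complex assume w: "w \<in> cball 0 \<rho>"
    have "cmod (E w - w) = cmod w * cmod (exp (l w - l 0) - 1)"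
      unfolding norm_mult[symmetric] by (simp add: E_def algebra_simps)
    also have "\<dots> \<le> 1 * e"
      using w \<rho> r d(2)[OF l_le[OF w]] by (intro mult_mono) auto
    finally show "cmod (E w - w) \<le> e" by simp
  next
    fix w :: complex assume w: "w \<in> ball 0 r"
    have "of_nat n * l w = of_nat n * t w - (\<Sum>j<n. g j w)"
      using n(1) by (simp add: l_def field_simps)
    then have "exp (of_nat n * l w) = exp (of_nat n * t w) / (\<Prod>j<n. \<psi> w - \<psi> (v j))"
      by (simp add: exp_diff exp_sum g(2)[OF w])
    moreover have "(\<Prod>j<n. \<psi> w - \<psi> (v j)) \<noteq> 0"
      using g(2)[OF w] by (simp flip: g(2)[OF w])
    ultimately have "exp (of_nat n * l w) * (\<Prod>j<n. \<psi> w - \<psi> (v j)) = T w ^ n"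
      by (simp add: exp_of_nat_mult t(2)[OF w])
    moreover have "E w ^ n = w ^ n * (c * exp (of_nat n * l w))"
      by (simp add: E_def c_def power_mult_distrib exp_of_nat_mult[symmetric] exp_add[symmetric] algebra_simps)
    ultimately have "E w ^ n * (\<Prod>j<n. \<psi> w - \<psi> (v j)) = c * (w * T w) ^ n"
      by (simp add: power_mult_distrib)
    then show "c * (\<psi> w - \<psi> 0) ^ n = E w ^ n * (\<Prod>j<n. \<psi> w - \<psi> (v j))"
      by (simp add: T_def split: if_splits)
  qed (use n(1) v in \<open>auto simp: E_def c_def\<close>)
qed

end

section \<open>Level curves of rational functions\<close>

text \<open>Cauchy's inequality on discs of radius \<open>2 * e\<close> bounds the derivative of
  \<open>E w - w\<close> by \<open>1 / 2\<close> on the disc of radius \<open>\<rho> + e\<close>.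
  There \<open>E\<close> shrinks distances at most by a factor \<open>2\<close>, so it is injective
  with a Lipschitz inverse. Brouwer's theorem provides the preimages.\<close>

lemma near_identity_inverse:
  assumes hol: "E holomorphic_on ball 0 r" and "0 < \<rho>" "0 < e" "\<rho> + 3 * e < r"
    and near: "\<And>w. w \<in> cball 0 (\<rho> + 3 * e) \<Longrightarrow> cmod (E w - w) \<le> e"
  obtains \<theta> where "continuous_on (cball 0 \<rho>) \<theta>" "inj_on \<theta> (cball 0 \<rho>)"
    "\<theta> ` cball 0 \<rho> \<subseteq> cball 0 (\<rho> + e)" "\<And>\<zeta>. \<zeta> \<in> cball 0 \<rho> \<Longrightarrow> E (\<theta> \<zeta>) = \<zeta>"
    "\<And>w. w \<in> cball 0 (\<rho> + e) \<Longrightarrow> E w \<in> cball 0 \<rho> \<Longrightarrow> \<theta> (E w) = w"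
proof -
  let ?B = "cball (0::complex) (\<rho> + e)"
  define f where "f = (\<lambda>w. E w - w)"
  have f: "f holomorphic_on ball 0 r"
    unfolding f_def using hol by (auto intro!: holomorphic_intros)
  have df: "cmod (deriv f w) \<le> 1 / 2" if w: "w \<in> ?B" for w
  proof -
    have sub: "cball w (2 * e) \<subseteq> cball 0 (\<rho> + 3 * e)"
    proof
      fix x assume "x \<in> cball w (2 * e)"
      then show "x \<in> cball 0 (\<rho> + 3 * e)"
        using w norm_triangle_ineq[of w "x - w"] by (auto simp: dist_norm norm_minus_commute)
    qed
    then have sub2: "cball w (2 * e) \<subseteq> ball 0 r" using assms by auto
    have "cmod ((deriv ^^ 1) f w) \<le> fact 1 * e / (2 * e) ^ 1"
    proof (rule Cauchy_inequality)
      show "f holomorphic_on ball w (2 * e)" "continuous_on (cball w (2 * e)) f"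
        using f sub2 by (meson holomorphic_on_subset holomorphic_on_imp_continuous_on ball_subset_cball order_trans)+
      show "cmod (f x) \<le> e" if "cmod (w - x) = 2 * e" for x
        using near[of x] that sub by (auto simp: f_def dist_norm subset_iff)
    qed (use \<open>0 < e\<close> in auto)
    then show ?thesis using \<open>0 < e\<close> by simp
  qed
  have lip: "cmod (x - y) \<le> 2 * cmod (E x - E y)" if xy: "x \<in> ?B" "y \<in> ?B" for x y
  proof -
    have "cmod (f x - f y) \<le> 1 / 2 * cmod (x - y)"
    proof (rule field_differentiable_bound[OF convex_cball[of 0 "\<rho> + e"]])
      show "(f has_field_derivative deriv f z) (at z within ?B)" if "z \<in> ?B" for z
        using that f assms by (intro holomorphic_derivI[of _ "ball 0 r"]) auto
    qed (use df xy in auto)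
    moreover have "x - y = (E x - E y) - (f x - f y)" by (simp add: f_def)
    ultimately show ?thesis using norm_triangle_ineq4[of "E x - E y" "f x - f y"] by simp
  qed
  have surj: "\<exists>w\<in>?B. E w = \<zeta>" if \<zeta>: "\<zeta> \<in> cball 0 \<rho>" for \<zeta>
  proof -
    have sub: "cball \<zeta> e \<subseteq> ?B"
    proof
      fix x assume "x \<in> cball \<zeta> e"
      then show "x \<in> ?B"
        using \<zeta> norm_triangle_ineq[of \<zeta> "x - \<zeta>"] by (auto simp: dist_norm norm_minus_commute)
    qed
    \<comment> \<open>A fixed point of \<open>\<lambda>w. \<zeta> - f w\<close> solves
      \<open>E w = \<zeta>\<close>, and the bound on \<open>f\<close> makes this map send
      \<open>cball \<zeta> e\<close> into itself.\<close>
    have "continuous_on (cball \<zeta> e) (\<lambda>w. \<zeta> - f w)"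
    proof (intro continuous_intros)
      show "continuous_on (cball \<zeta> e) f"
        using sub assms by (intro holomorphic_on_imp_continuous_on holomorphic_on_subset[OF f]) auto
    qed
    moreover have "(\<lambda>w. \<zeta> - f w) \<in> cball \<zeta> e \<rightarrow> cball \<zeta> e"
    proof
      fix w assume "w \<in> cball \<zeta> e"
      then have "w \<in> cball 0 (\<rho> + 3 * e)" using sub \<open>0 < e\<close> by auto
      then show "\<zeta> - f w \<in> cball \<zeta> e" using near by (auto simp: f_def dist_norm)
    qed
    ultimately obtain w where "w \<in> cball \<zeta> e" "\<zeta> - f w = w"
      using brouwer_ball[OF \<open>0 < e\<close>] by blast
    then show ?thesis using sub by (intro bexI[of _ w]) (auto simp: f_def algebra_simps)
  qed
  then obtain \<theta> where \<theta>: "\<And>\<zeta>. \<zeta> \<in> cball 0 \<rho> \<Longrightarrow> \<theta> \<zeta> \<in> ?B" "\<And>\<zeta>. \<zeta> \<in> cball 0 \<rho> \<Longrightarrow> E (\<theta> \<zeta>) = \<zeta>"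
    by metis
  show ?thesis
  proof (rule that[of \<theta>])
    have "2-lipschitz_on (cball 0 \<rho>) \<theta>"
    proof (rule lipschitz_onI)
      fix x y :: complex assume xy: "x \<in> cball 0 \<rho>" "y \<in> cball 0 \<rho>"
      show "dist (\<theta> x) (\<theta> y) \<le> 2 * dist x y"
        using lip[OF \<theta>(1)[OF xy(1)] \<theta>(1)[OF xy(2)]] \<theta>(2)[OF xy(1)] \<theta>(2)[OF xy(2)]
        by (simp add: dist_norm)
    qed simp
    then show "continuous_on (cball 0 \<rho>) \<theta>" by (rule lipschitz_on_continuous_on)
    show "inj_on \<theta> (cball 0 \<rho>)" by (rule inj_on_inverseI[of _ E]) (use \<theta> in auto)
    show "\<theta> (E w) = w" if "w \<in> ?B" "E w \<in> cball 0 \<rho>" for w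
      using lip[OF \<theta>(1)[OF that(2)] that(1)] \<theta>(2)[OF that(2)] by simp
  qed (use \<theta> in auto)
qed

text \<open>Invariance of domain makes the image of the open disc open, and its frontier lies in the
  curve. Being connected, it lies in the inside or in the outside, and the one that contains it
  equals it. The outside is unbounded, which leaves the inside.\<close>

lemma Jordan_disc:
  fixes \<theta> :: "complex \<Rightarrow> complex"
  assumes cont: "continuous_on (cball 0 \<rho>) \<theta>" and inj: "inj_on \<theta> (cball 0 \<rho>)" and "\<rho> > 0"
  shows "Jordan_curve_set (\<theta> ` sphere 0 \<rho>)" and "inside (\<theta> ` sphere 0 \<rho>) = \<theta> ` ball 0 \<rho>"
proof -
  define c where "c = \<theta> \<circ> circlepath 0 \<rho>"
  have sub: "sphere (0::complex) \<rho> \<subseteq> cball 0 \<rho>" by auto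
  have pc: "path_image (circlepath 0 \<rho>) = sphere 0 \<rho>" using \<open>\<rho> > 0\<close> by simp
  have c: "simple_path c" "pathfinish c = pathstart c" "path_image c = \<theta> ` sphere 0 \<rho>"
    unfolding c_def using \<open>\<rho> > 0\<close> continuous_on_subset[OF cont sub] inj_on_subset[OF inj sub]
    by (auto intro!: simple_path_continuous_image
        simp: simple_path_circlepath pc path_image_compose pathfinish_compose pathstart_compose)
  then show Jc: "Jordan_curve_set (\<theta> ` sphere 0 \<rho>)" by (auto simp: Jordan_curve_set_def)
  let ?\<Gamma> = "\<theta> ` sphere 0 \<rho>" and ?U = "\<theta> ` ball 0 \<rho>"
  note J = Jordan_curve_set_props[OF Jc]
  have "open ?U"
    by (rule invariance_of_domain[OF continuous_on_subset[OF cont] open_ball inj_on_subset[OF inj]]) auto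
  moreover have "closure ?U \<subseteq> \<theta> ` cball 0 \<rho>"
    by (rule closure_minimal) (auto intro!: compact_imp_closed compact_continuous_image cont)
  moreover have "\<theta> ` cball 0 \<rho> \<subseteq> ?U \<union> ?\<Gamma>" by (force simp: dist_norm)
  ultimately have fr: "frontier ?U \<subseteq> ?\<Gamma>"
    unfolding frontier_def by (simp add: interior_open) blast
  have disj: "?U \<inter> ?\<Gamma> = {}"
  proof -
    have "ball 0 \<rho> \<inter> sphere (0::complex) \<rho> = {}" by auto
    then show ?thesis using inj_on_image_Int[OF inj, of "ball 0 \<rho>" "sphere 0 \<rho>"] by (auto simp: ball_subset_cball)
  qed
  have bdd: "bounded ?U"
    using compact_imp_bounded[OF compact_continuous_image[OF cont compact_cball]]
    by (rule bounded_subset) auto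
  have conn: "connected ?U"
    by (rule connected_continuous_image[OF continuous_on_subset[OF cont]]) auto
  have ne: "?U \<noteq> {}" using \<open>\<rho> > 0\<close> by auto
  \<comment> \<open>A connected set that contains the image of the disc and misses its frontier
    cannot be larger.\<close>
  have *: "X = ?U" if "connected X" "X \<inter> ?\<Gamma> = {}" "X \<inter> ?U \<noteq> {}" "?U \<subseteq> X" for X
    using connected_Int_frontier[OF that(1,3)] that fr by blast
  have sub_io: "?U \<subseteq> inside ?\<Gamma> \<union> outside ?\<Gamma>" using J(9) disj by blast
  have io: "inside ?\<Gamma> \<inter> outside ?\<Gamma> \<inter> ?U = {}" using inside_Int_outside by blast
  have "inside ?\<Gamma> \<inter> ?\<Gamma> = {}" "outside ?\<Gamma> \<inter> ?\<Gamma> = {}"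
    by (simp_all add: inside_no_overlap outside_no_overlap)
  note eqU = *[OF J(4) this(1)] *[OF J(8) this(2)]
  from connectedD[OF conn J(3,7) io sub_io] show "inside ?\<Gamma> = ?U"
  proof
    assume "inside ?\<Gamma> \<inter> ?U = {}"
    then have "?U \<subseteq> outside ?\<Gamma>" using sub_io by blast
    then have "outside ?\<Gamma> = ?U" using ne by (intro eqU(2)) blast+
    moreover have "\<not> bounded (outside ?\<Gamma>)"
      using compact_imp_bounded[OF J(1)] unbounded_outside by blast
    ultimately show ?thesis using bdd by metis
  next
    assume "outside ?\<Gamma> \<inter> ?U = {}"
    then have "?U \<subseteq> inside ?\<Gamma>" using sub_io by blast
    then show ?thesis using ne by (intro eqU(1)) blast+
  qed
qed

text \<open>\<open>K\<close> consists of the points of the closure of \<open>\<Omega>\<close> far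
  from the frontier and of finitely many points close to it. The first part pushes the frontier of
  \<open>U\<close> towards that of \<open>\<Omega>\<close>. The second puts a point of
  \<open>U\<close> near each frontier point of \<open>\<Omega>\<close>, and a ball that meets both
  \<open>U\<close> and its complement meets the frontier of \<open>U\<close>.\<close>

lemma frontier_approximation:
  fixes \<Omega> :: "'a::euclidean_space set"
  assumes "open \<Omega>" "bounded \<Omega>" "e > 0"
  obtains K where "compact K" "K \<subseteq> \<Omega>"
    "\<And>U x. open U \<Longrightarrow> K \<subseteq> U \<Longrightarrow> closure U \<subseteq> \<Omega> \<Longrightarrow> x \<in> frontier \<Omega> \<Longrightarrow> \<exists>y\<in>frontier U. dist x y < e"
    "\<And>U y. open U \<Longrightarrow> K \<subseteq> U \<Longrightarrow> closure U \<subseteq> \<Omega> \<Longrightarrow> y \<in> frontier U \<Longrightarrow> \<exists>x\<in>frontier \<Omega>. dist y x < e"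
proof -
  have comp: "compact (frontier \<Omega>)" using \<open>bounded \<Omega>\<close> by (rule compact_frontier_bounded)
  have "\<exists>w\<in>\<Omega>. dist w x < e / 2" if "x \<in> frontier \<Omega>" for x
  proof -
    have "x \<in> closure \<Omega>" using that by (simp add: frontier_def)
    then show ?thesis using half_gt_zero[OF \<open>e > 0\<close>] closure_approachable by blast
  qed
  then obtain w where w: "\<And>x. x \<in> frontier \<Omega> \<Longrightarrow> w x \<in> \<Omega>" "\<And>x. x \<in> frontier \<Omega> \<Longrightarrow> dist (w x) x < e / 2"
    by metis
  obtain A where A: "A \<subseteq> frontier \<Omega>" "finite A" "frontier \<Omega> \<subseteq> (\<Union>a\<in>A. ball a (e / 2))"
  proof (rule compactE_image[OF comp, of "frontier \<Omega>" "\<lambda>a. ball a (e / 2)"])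
    show "frontier \<Omega> \<subseteq> (\<Union>a\<in>frontier \<Omega>. ball a (e / 2))" using \<open>e > 0\<close> by auto
  qed auto
  define N where "N = (\<Union>x\<in>frontier \<Omega>. ball x e)"
  define K where "K = (closure \<Omega> - N) \<union> w ` A"
  have N: "frontier \<Omega> \<subseteq> N" "open N" using \<open>e > 0\<close> by (auto simp: N_def)
  show ?thesis
  proof (rule that[of K])
    have "compact (closure \<Omega> - N)"
      using N \<open>bounded \<Omega>\<close> by (intro compact_diff) (auto simp: compact_closure)
    then show "compact K"
      unfolding K_def using A(2) by (intro compact_Un finite_imp_compact[of "w ` A"]) auto
    show "K \<subseteq> \<Omega>"
      using N A w(1) \<open>open \<Omega>\<close> by (auto simp: K_def frontier_def interior_open)
    fix U assume U: "open U" "K \<subseteq> U" "closure U \<subseteq> \<Omega>"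
    show "\<exists>y\<in>frontier U. dist x y < e" if x: "x \<in> frontier \<Omega>" for x
    proof -
      obtain a where a: "a \<in> A" "dist a x < e / 2" using A(3) x by auto
      then have "dist x (w a) < e"
        using w(2)[of a] A(1) by (meson dist_commute dist_triangle_half_l subsetD dist_commute_lessI)
      then have "w a \<in> ball x e \<inter> U" using a U(2) by (auto simp: K_def)
      then have "ball x e \<inter> U \<noteq> {}" by blast
      moreover have "x \<notin> U" using x U(3) closure_subset \<open>open \<Omega>\<close> by (auto simp: frontier_def interior_open)
      then have "x \<in> ball x e - U" using \<open>e > 0\<close> by simp
      then have "ball x e - U \<noteq> {}" by blast
      ultimately have "ball x e \<inter> frontier U \<noteq> {}" by (rule connected_Int_frontier[OF connected_ball])
      then show ?thesis by auto
    qed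
    show "\<exists>x\<in>frontier \<Omega>. dist y x < e" if y: "y \<in> frontier U" for y
    proof -
      have "y \<in> \<Omega>" "y \<notin> K" using y U by (auto simp: frontier_def interior_open)
      then have "y \<in> N" using closure_subset by (auto simp: K_def)
      then show ?thesis by (auto simp: N_def dist_commute)
    qed
  qed
qed

text \<open>On the curve \<open>R\<close> has modulus \<open>k\<close>, so it is the conjugate of
  \<open>k\<^sup>2 / R\<close>. The poles of \<open>R\<close> avoid the closed inside, and
  \<open>k\<^sup>2 / R\<close> has no pole except at \<open>z0\<close>, hence none outside.
  Numerator and denominator of \<open>R\<close> are monic of the same degree, so
  \<open>k\<^sup>2 / R\<close> tends to the real number \<open>k\<^sup>2\<close> at infinity;
  subtracting it from both functions preserves the relation.\<close>

lemma MP_solvable_rational: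
  fixes p :: "nat \<Rightarrow> complex"
  assumes \<Gamma>: "Jordan_curve_set \<Gamma>" and z0: "z0 \<in> inside \<Gamma>" and p: "\<And>j. p j \<notin> closure (inside \<Gamma>)"
    and modulus: "\<And>z. z \<in> \<Gamma> \<Longrightarrow> cmod ((z - z0) ^ n) = k * cmod (\<Prod>j<n. z - p j)" 
    and nonconst: "\<not> (\<lambda>z. (z - z0) ^ n / (\<Prod>j<n. z - p j)) constant_on \<Gamma>"
  shows "MP_solvable \<Gamma>"
proof -
  note openin = Jordan_curve_set_props(3,7)[OF \<Gamma>]
  have fr: "\<Gamma> \<subseteq> closure (inside \<Gamma>)" "\<Gamma> \<subseteq> closure (outside \<Gamma>)"
    using Jordan_curve_set_props(10,11)[OF \<Gamma>] by (auto simp: frontier_def)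
  define R where "R = (\<lambda>z. (z - z0) ^ n / (\<Prod>j<n. z - p j))"
  define K where "K = complex_of_real (k\<^sup>2)"
  define f where "f = (\<lambda>z. R z - K)"
  define G where "G = (\<lambda>z. K * (\<Prod>j<n. z - p j) / (z - z0) ^ n - K)"
  define g where "g = (\<lambda>x. case x of None \<Rightarrow> 0 | Some z \<Rightarrow> G z)"
  have gS: "g \<circ> Some = G" "g None = 0" by (auto simp: g_def)
  have pnz: "(\<Prod>j<n. z - p j) \<noteq> 0" if "z \<in> closure (inside \<Gamma>)" for z
    using p that by auto
  have z0': "z0 \<notin> \<Gamma>" "z0 \<notin> outside \<Gamma>"
    using z0 inside_no_overlap inside_Int_outside by blast+
  have match: "f z = cnj (G z)" if z: "z \<in> \<Gamma>" for z
  proof -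
    let ?s = "\<Prod>j<n. z - p j" and ?t = "(z - z0) ^ n"
    have nz: "?s \<noteq> 0" "?t \<noteq> 0" using pnz fr z z0' by auto
    have "?t * cnj ?t = K * (?s * cnj ?s)"
      unfolding complex_norm_square[symmetric] modulus[OF z] K_def by (simp add: power_mult_distrib)
    moreover have "t / s = K * s' / t'" if "t * t' = K * (s * s')" "s \<noteq> 0" "t' \<noteq> 0" for s t s' t'
      using that by (simp add: frac_eq_eq mult_ac)
    ultimately have "?t / ?s = K * cnj ?s / cnj ?t"
      using nz by (metis complex_cnj_zero_iff)
    moreover have "cnj K = K" by (simp add: K_def)
    ultimately show ?thesis by (simp add: f_def R_def G_def)
  qed
  have holG: "G holomorphic_on - {z0}"
    unfolding G_def by (auto intro!: holomorphic_intros)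
  \<comment> \<open>In the coordinate \<open>w = 1 / z\<close> the powers of \<open>w\<close>
    cancel, and the resulting formula stays valid at \<open>w = 0\<close>, where it
    vanishes.\<close>
  have chart: "(g \<circ> chart_at_infinity) w = K * (\<Prod>j<n. 1 - w * p j) / (1 - w * z0) ^ n - K" for w
  proof (cases "w = 0")
    case False
    have "(\<Prod>j<n. 1 / w - p j) = (\<Prod>j<n. (1 - w * p j) / w)"
      using False by (intro prod.cong) (auto simp: field_simps)
    moreover have "1 / w - z0 = (1 - w * z0) / w" using False by (simp add: field_simps)
    ultimately show ?thesis
      using False by (simp add: chart_at_infinity_def g_def G_def prod_dividef power_divide)
  qed (simp add: chart_at_infinity_def g_def)
  have tend: "(G \<longlongrightarrow> 0) at_infinity"
  proof -
    have "((\<lambda>w. K * (\<Prod>j<n. 1 - w * p j) / (1 - w * z0) ^ n - K) \<longlongrightarrow>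
        K * (\<Prod>j<n. 1 - 0 * p j) / (1 - 0 * z0) ^ n - K) (at 0)"
      by (intro tendsto_intros) auto
    then have "((\<lambda>w. (g \<circ> chart_at_infinity) w) \<longlongrightarrow> 0) (at 0)"
      unfolding chart by simp
    then have "((\<lambda>w. G (inverse w)) \<longlongrightarrow> 0) (at 0)"
      by (rule Lim_transform_eventually)
         (auto simp: eventually_at_filter chart_at_infinity_def g_def field_simps)
    then show ?thesis by (simp add: lim_at_infinity_0 o_def)
  qed
  have "f \<in> A_int \<Gamma>"
  proof -
    have "f holomorphic_on inside \<Gamma>"
      unfolding f_def R_def using pnz closure_subset by (intro holomorphic_intros) blast+
    moreover have "continuous_on (closure (inside \<Gamma>)) f"
      unfolding f_def R_def using pnz by (intro continuous_intros) auto
    ultimately show ?thesis using openin by (simp add: A_int_def int_domain_def analytic_on_open)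
  qed
  moreover have "g \<in> A_ext \<Gamma>"
  proof -
    have "Riemann_sphere closure_of ext_domain \<Gamma> \<subseteq> - Some ` inside \<Gamma>"
      by (rule closure_of_ext_domain_subset[OF openin(1)]) simp
    then have "continuous_map (subtopology Riemann_sphere (Riemann_sphere closure_of ext_domain \<Gamma>)) euclidean g"
      using z0 holG tend
      by (intro continuous_map_Riemann_sphere[of "- {z0}"]) (auto simp: g_def intro!: holomorphic_on_imp_continuous_on)
    moreover have "sphere_analytic_on g (ext_domain \<Gamma>)"
      unfolding sphere_analytic_on_def
    proof
      have eq: "Some -` ext_domain \<Gamma> = outside \<Gamma>" by (auto simp: ext_domain_def)
      show "(g \<circ> Some) analytic_on Some -` ext_domain \<Gamma>"
        unfolding eq gS using holG z0' openin by (auto simp: analytic_on_open elim!: holomorphic_on_subset)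
      \<comment> \<open>The factor vanishes only if \<open>w\<close> is the chart coordinate of
        \<open>z0\<close>, which is a point of the inside.\<close>
      have nz: "1 - w * z0 \<noteq> 0" if "w \<in> chart_at_infinity -` ext_domain \<Gamma>" for w
      proof
        assume "1 - w * z0 = 0"
        then have 1: "w * z0 = 1" by simp
        then have "w \<noteq> 0" by auto
        moreover from this have "1 / w = z0" using 1 by (simp add: field_simps)
        ultimately have "w \<noteq> 0" "1 / w = z0" by auto
        then show False using that z0' by (auto simp: chart_at_infinity_def ext_domain_def)
      qed
      have "(\<lambda>w. K * (\<Prod>j<n. 1 - w * p j) / (1 - w * z0) ^ n - K) analytic_on chart_at_infinity -` ext_domain \<Gamma>"
        by (intro analytic_intros) (use nz in auto)
      then show "(g \<circ> chart_at_infinity) analytic_on chart_at_infinity -` ext_domain \<Gamma>"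
        unfolding chart[abs_def, symmetric] by (simp add: o_def)
    qed
    ultimately show ?thesis by (simp add: A_ext_def g_def)
  qed
  moreover have "\<not> f constant_on closure (int_domain \<Gamma>)"
  proof
    assume "f constant_on closure (int_domain \<Gamma>)"
    then have "f constant_on \<Gamma>" using fr by (metis constant_on_subset int_domain_def)
    then have "R constant_on \<Gamma>" unfolding constant_on_def f_def by (metis diff_add_cancel)
    then show False using nonconst by (simp add: R_def)
  qed
  moreover have "\<not> g constant_on (Riemann_sphere closure_of ext_domain \<Gamma>)"
  proof
    assume const: "g constant_on (Riemann_sphere closure_of ext_domain \<Gamma>)"
    have "Some z \<in> Riemann_sphere closure_of ext_domain \<Gamma>" if "z \<in> \<Gamma>" for z
      using closure_outside_ext_domain fr(2) that by blast
    then have "G constant_on \<Gamma>" using const unfolding constant_on_def g_def by force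
    then obtain c where "\<And>z. z \<in> \<Gamma> \<Longrightarrow> G z = c" by (auto simp: constant_on_def)
    \<comment> \<open>The boundary relation turns constancy of \<open>g\<close> on the curve into
      constancy of \<open>R\<close> there.\<close>
    then have "R z = cnj c + K" if "z \<in> \<Gamma>" for z
      using match[OF that] that by (simp add: f_def algebra_simps)
    then have "R constant_on \<Gamma>" unfolding constant_on_def by blast
    then show False using nonconst by (simp add: R_def)
  qed
  ultimately show ?thesis
    unfolding MP_solvable_def using match by (auto simp: g_def intro!: bexI[of _ f] bexI[of _ g])
qed

section \<open>Conformal maps and the nearby solvable curve\<close>

lemma MP_solvable_near:
  assumes \<Gamma>: "Jordan_curve_set \<Gamma>" and "\<epsilon> > 0"
  shows "\<exists>\<Gamma>'. Jordan_curve_set \<Gamma>' \<and> MP_solvable \<Gamma>' \<and> Hausdorff_dist \<Gamma> \<Gamma>' < \<epsilon>"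
proof -
  note J = Jordan_curve_set_props[OF \<Gamma>]
  let ?\<Omega> = "inside \<Gamma>"
  have "?\<Omega> \<noteq> UNIV" using J(6) not_bounded_UNIV by metis
  then obtain \<phi> \<psi> where \<phi>: "\<phi> holomorphic_on ?\<Omega>" and \<psi>: "\<psi> holomorphic_on ball 0 1"
    and \<phi>\<psi>: "\<And>z. z \<in> ?\<Omega> \<Longrightarrow> \<phi> z \<in> ball 0 1 \<and> \<psi> (\<phi> z) = z" "\<And>w. w \<in> ball 0 1 \<Longrightarrow> \<psi> w \<in> ?\<Omega> \<and> \<phi> (\<psi> w) = w"
    using Riemann_mapping_theorem[of ?\<Omega>] J by metis
  have inj: "inj_on \<psi> (ball 0 1)" by (metis \<phi>\<psi>(2) inj_onI)
  have eps2: "\<epsilon> / 2 > 0" using \<open>\<epsilon> > 0\<close> by simp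
  obtain K where K: "compact K" "K \<subseteq> ?\<Omega>"
    "\<And>U x. open U \<Longrightarrow> K \<subseteq> U \<Longrightarrow> closure U \<subseteq> ?\<Omega> \<Longrightarrow> x \<in> frontier ?\<Omega> \<Longrightarrow> \<exists>y\<in>frontier U. dist x y < \<epsilon> / 2"
    "\<And>U y. open U \<Longrightarrow> K \<subseteq> U \<Longrightarrow> closure U \<subseteq> ?\<Omega> \<Longrightarrow> y \<in> frontier U \<Longrightarrow> \<exists>x\<in>frontier ?\<Omega>. dist y x < \<epsilon> / 2"
    using frontier_approximation[OF J(3,6) eps2] by metis
  have cK: "compact (\<phi> ` K)"
    using K \<phi> by (intro compact_continuous_image holomorphic_on_imp_continuous_on) (auto elim: holomorphic_on_subset)
  have "\<exists>r0. 0 < r0 \<and> r0 < 1 \<and> (\<forall>z\<in>K. cmod (\<phi> z) \<le> r0)"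
  proof (cases "K = {}")
    case False
    then obtain z where z: "z \<in> K" "\<And>y. y \<in> K \<Longrightarrow> cmod (\<phi> y) \<le> cmod (\<phi> z)"
      using continuous_attains_sup[OF cK, of norm] by (auto intro!: continuous_intros)
    moreover have "cmod (\<phi> z) < 1" using \<phi>\<psi>(1) K(2) \<open>z \<in> K\<close> by auto
    ultimately show ?thesis
      using z(2) by (intro exI[of _ "max (1/2) (cmod (\<phi> z))"]) (auto intro: max.coboundedI2)
  qed (auto intro: exI[of _ "1/2"])
  then obtain r0 where r0: "0 < r0" "r0 < 1" "\<And>z. z \<in> K \<Longrightarrow> cmod (\<phi> z) \<le> r0" by auto
  \<comment> \<open>This leaves room for all radii: \<open>r = r0 + 6 * e\<close> stays below
    \<open>1\<close>, and \<open>r0 + e < \<rho>\<close> lets the new curve enclose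
    \<open>K\<close>.\<close>
  define e where "e = (1 - r0) / 10"
  define \<rho> where "\<rho> = r0 + 2 * e"
  define r where "r = \<rho> + 4 * e"
  have e: "0 < e" "0 < \<rho>" "\<rho> + 3 * e < r" "0 < r" "r < 1" "0 < \<rho> + 3 * e"
  proof -
    have "10 * e = 1 - r0" by (simp add: e_def)
    then show "0 < e" "0 < \<rho>" "\<rho> + 3 * e < r" "0 < r" "r < 1" "0 < \<rho> + 3 * e"
      using r0(1,2) unfolding \<rho>_def r_def by linarith+
  qed
  obtain n E p c where n: "n > 0" and E: "E holomorphic_on ball 0 r" "E 0 = 0" "c \<noteq> 0"
    "\<And>w. w \<in> cball 0 (\<rho> + 3 * e) \<Longrightarrow> cmod (E w - w) \<le> e"
    "\<And>j. p j \<in> \<psi> ` sphere 0 r"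
    "\<And>w. w \<in> ball 0 r \<Longrightarrow> c * (\<psi> w - \<psi> 0) ^ n = E w ^ n * (\<Prod>j<n. \<psi> w - p j)"
    using rational_root_near_identity[OF \<psi> inj e(4,5,6,3,1)] by metis
  obtain \<theta> where \<theta>: "continuous_on (cball 0 \<rho>) \<theta>" "inj_on \<theta> (cball 0 \<rho>)"
    "\<theta> ` cball 0 \<rho> \<subseteq> cball 0 (\<rho> + e)" "\<And>\<zeta>. \<zeta> \<in> cball 0 \<rho> \<Longrightarrow> E (\<theta> \<zeta>) = \<zeta>"
    "\<And>w. w \<in> cball 0 (\<rho> + e) \<Longrightarrow> E w \<in> cball 0 \<rho> \<Longrightarrow> \<theta> (E w) = w"
    using near_identity_inverse[OF E(1) e(2,1,3) E(4)] by metis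
  have sub: "cball (0::complex) (\<rho> + e) \<subseteq> ball 0 r" "ball 0 r \<subseteq> ball (0::complex) 1" 
    using e by auto
  have \<theta>r: "\<theta> \<zeta> \<in> ball 0 r" if "\<zeta> \<in> cball 0 \<rho>" for \<zeta>
    using \<theta>(3) sub that by blast
  \<comment> \<open>Since \<open>\<theta>\<close> inverts \<open>E\<close>, the rational function
    becomes \<open>\<zeta> ^ n / c\<close> along \<open>\<tau>\<close>, and its modulus is constant
    on the circle of radius \<open>\<rho>\<close>.\<close>
  define \<tau> where "\<tau> = \<psi> \<circ> \<theta>"
  have \<tau>c: "continuous_on (cball 0 \<rho>) \<tau>"
    unfolding \<tau>_def using \<theta>r sub holomorphic_on_imp_continuous_on[OF \<psi>]
    by (intro continuous_on_compose \<theta>(1)) (auto elim!: continuous_on_subset)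
  have \<tau>i: "inj_on \<tau> (cball 0 \<rho>)"
    unfolding \<tau>_def using \<theta>r sub by (intro comp_inj_on \<theta>(2) inj_on_subset[OF inj]) auto
  define \<Gamma>' where "\<Gamma>' = \<tau> ` sphere 0 \<rho>"
  have J': "Jordan_curve_set \<Gamma>'" and in': "inside \<Gamma>' = \<tau> ` ball 0 \<rho>"
    unfolding \<Gamma>'_def using Jordan_disc[OF \<tau>c \<tau>i e(2)] by auto
  note P = Jordan_curve_set_props[OF J']
  have clo: "closure (inside \<Gamma>') = inside \<Gamma>' \<union> \<Gamma>'"
    using P(10) closure_Un_frontier by metis
  have cl': "closure (inside \<Gamma>') = \<tau> ` cball 0 \<rho>"
  proof -
    have "closure (inside \<Gamma>') = \<tau> ` (ball 0 \<rho> \<union> sphere 0 \<rho>)"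
      using clo in' by (simp add: image_Un flip: \<Gamma>'_def)
    also have "ball 0 \<rho> \<union> sphere 0 \<rho> = cball (0::complex) \<rho>" by auto
    finally show ?thesis .
  qed
  have \<tau>\<Omega>: "\<tau> ` cball 0 \<rho> \<subseteq> ?\<Omega>" using \<theta>r sub \<phi>\<psi>(2) by (auto simp: \<tau>_def subset_iff)
  have key: "c * (\<tau> \<zeta> - \<psi> 0) ^ n = \<zeta> ^ n * (\<Prod>j<n. \<tau> \<zeta> - p j)" if "\<zeta> \<in> cball 0 \<rho>" for \<zeta>
    using E(6)[OF \<theta>r[OF that]] \<theta>(4)[OF that] by (simp add: \<tau>_def)
  \<comment> \<open>The \<open>p j\<close> are images of points of modulus \<open>r\<close>, while
    \<open>\<theta>\<close> takes values of modulus below \<open>r\<close>; injectivity of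
    \<open>\<psi>\<close> separates them.\<close>
  have pout: "p j \<notin> closure (inside \<Gamma>')" for j
  proof
    assume "p j \<in> closure (inside \<Gamma>')"
    then obtain \<zeta> where "\<zeta> \<in> cball 0 \<rho>" "p j = \<psi> (\<theta> \<zeta>)" unfolding cl' by (auto simp: \<tau>_def)
    moreover obtain v where "v \<in> sphere 0 r" "p j = \<psi> v" using E(5) by blast
    ultimately have "\<theta> \<zeta> = v" using inj \<theta>r[of \<zeta>] sub e unfolding inj_on_def by (auto simp: subset_iff)
    then show False using \<theta>r[OF \<open>\<zeta> \<in> cball 0 \<rho>\<close>] \<open>v \<in> sphere 0 r\<close> by auto
  qed
  have "MP_solvable \<Gamma>'"
  proof (rule MP_solvable_rational[OF J', of "\<psi> 0" p n "\<rho> ^ n / cmod c"])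
    have "\<theta> 0 = 0" using \<theta>(5)[of 0] e E(2) by simp
    then have "\<tau> 0 = \<psi> 0" by (simp add: \<tau>_def)
    then show "\<psi> 0 \<in> inside \<Gamma>'" unfolding in' using e by (metis centre_in_ball imageI)
    show "cmod ((z - \<psi> 0) ^ n) = \<rho> ^ n / cmod c * cmod (\<Prod>j<n. z - p j)" if z: "z \<in> \<Gamma>'" for z
    proof -
      obtain \<zeta> where \<zeta>: "cmod \<zeta> = \<rho>" "z = \<tau> \<zeta>" using z by (auto simp: \<Gamma>'_def)
      then have "cmod (c * (z - \<psi> 0) ^ n) = cmod (\<zeta> ^ n * (\<Prod>j<n. z - p j))" using key[of \<zeta>] by simp
      then show ?thesis using \<zeta>(1) E(3) by (simp add: norm_mult norm_power field_simps)
    qed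
    show "\<not> (\<lambda>z. (z - \<psi> 0) ^ n / (\<Prod>j<n. z - p j)) constant_on \<Gamma>'"
    proof
      assume "(\<lambda>z. (z - \<psi> 0) ^ n / (\<Prod>j<n. z - p j)) constant_on \<Gamma>'"
      then obtain C where C: "\<And>z. z \<in> \<Gamma>' \<Longrightarrow> (z - \<psi> 0) ^ n / (\<Prod>j<n. z - p j) = C"
        by (auto simp: constant_on_def)
      have "\<zeta> ^ n = c * C" if "cmod \<zeta> = \<rho>" for \<zeta>
      proof -
        have "\<tau> \<zeta> \<in> \<Gamma>'" using that by (auto simp: \<Gamma>'_def)
        moreover from this have "(\<Prod>j<n. \<tau> \<zeta> - p j) \<noteq> 0" using pout clo by auto
        ultimately show ?thesis using key[of \<zeta>] C[of "\<tau> \<zeta>"] that by (auto simp: field_simps)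
      qed
      \<comment> \<open>The points \<open>\<rho>\<close> and \<open>\<rho> * cis (pi / n)\<close> of
        the circle have opposite \<open>n\<close>-th powers.\<close>
      from this[of "of_real \<rho>"] this[of "of_real \<rho> * cis (pi / n)"] 
      have "complex_of_real \<rho> ^ n = (of_real \<rho> * cis (pi / n)) ^ n"
        using e by (simp add: norm_mult)
      also have "\<dots> = - (of_real \<rho> ^ n)" using n by (simp add: power_mult_distrib Complex.DeMoivre)
      finally show False using e by (simp add: eq_neg_iff_add_eq_0 flip: mult_2)
    qed
  qed (use pout in auto)
  moreover have "Hausdorff_dist \<Gamma> \<Gamma>' \<le> \<epsilon> / 2"
  proof (rule Hausdorff_dist_le)
    \<comment> \<open>\<open>E\<close> moves \<open>\<phi> z\<close> by at most \<open>e\<close>,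
      hence into the open disc of radius \<open>\<rho>\<close>, and \<open>\<theta>\<close> brings
      it back.\<close>
    have "K \<subseteq> inside \<Gamma>'"
    proof
      fix z assume z: "z \<in> K"
      then have w: "cmod (\<phi> z) \<le> r0" "\<psi> (\<phi> z) = z" using r0 \<phi>\<psi>(1) K(2) by auto
      have "cmod (E (\<phi> z)) \<le> r0 + e"
        using E(4)[of "\<phi> z"] w(1) e norm_triangle_sub[of "E (\<phi> z)" "\<phi> z"] by (simp add: \<rho>_def)
      then have "\<theta> (E (\<phi> z)) = \<phi> z" "E (\<phi> z) \<in> ball 0 \<rho>" using w(1) e by (auto simp: \<rho>_def intro!: \<theta>(5))
      then show "z \<in> inside \<Gamma>'" unfolding in' using w(2) by (force simp: \<tau>_def)
    qed
    then have "x \<in> \<Gamma> \<Longrightarrow> \<exists>y\<in>\<Gamma>'. dist x y < \<epsilon> / 2" "y \<in> \<Gamma>' \<Longrightarrow> \<exists>x\<in>\<Gamma>. dist y x < \<epsilon> / 2" for x y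
      using K(3,4)[OF P(3)] \<tau>\<Omega> cl' J(10) P(10) by auto
    then show "x \<in> \<Gamma> \<Longrightarrow> \<exists>y\<in>\<Gamma>'. dist x y \<le> \<epsilon> / 2" "y \<in> \<Gamma>' \<Longrightarrow> \<exists>x\<in>\<Gamma>. dist y x \<le> \<epsilon> / 2" for x y
      by (meson less_imp_le)+
  qed (use J P in auto)
  ultimately show ?thesis using J' \<open>\<epsilon> > 0\<close> by (intro exI[of _ \<Gamma>']) auto
qed

theorem corollary5p1:
  fixes \<Gamma> :: "complex set" and \<epsilon> :: real
  assumes "Jordan_curve_set \<Gamma>" and "\<epsilon> > 0"
  shows "\<exists>\<Gamma>' \<Gamma>''.
           Jordan_curve_set \<Gamma>' \<and> MP_solvable \<Gamma>' \<and>
           Jordan_curve_set \<Gamma>'' \<and> \<not> MP_solvable \<Gamma>'' \<and>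
           Hausdorff_dist \<Gamma> \<Gamma>' < \<epsilon> \<and> Hausdorff_dist \<Gamma> \<Gamma>'' < \<epsilon>"
  using MP_solvable_near[OF assms] not_MP_solvable_near[OF assms] by blast

end
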